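(* Let $K$ be a field, $S=K[x_1,\ldots,x_n]$, and let $I$ be a monomial ideal of $S$ with minimal monomial generating set $\operatorname{G}(I)=\{u_1,\ldots,u_t\}$. If the sequence $u_1,\ldots,u_t$ is a $d$-sequence, or a proper sequence, or a strong $s$-sequence with respect to the reverse lexicographic order, then $S/I$ is pretty clean.
   Context: $S=K[x_1,\ldots,x_n]$ carries its standard $\mathbb{Z}^n$-grading (``multigrading''). $\operatorname{G}(I)$ denotes the unique minimal set of monomial generators of the monomial ideal $I$. Let $R$ be a commutative Noetherian ring and $f_1,\ldots,f_t\in R$. $d$-sequence: $f_1,\ldots,f_t$ is a $d$-sequence (on $R$) if it is a minimal generating set of the ideal $(f_1,\ldots,f_t)$ and $(f_1,\ldots,f_i):_R f_{i+1}f_k=(f_1,\ldots,f_i):_R f_k$ for all $0\le i<t$ and all $i+1\le k\le t$. Proper sequence: $f_1,\ldots,f_t$ is a proper sequence if $f_{i+1}H_j(f_1,\ldots,f_i;R)=0$ for all $0\le i<t$ and all $j>0$, where $H_j(f_1,\ldots,f_i;R)$ is the $j$th Koszul homology of $R$ with respect to $f_1,\ldots,f_i$. Strong $s$-sequence: let $M=(g_1,\ldots,g_t)$ be a finitely generated $R$-module with generators $g_1,\ldots,g_t$ and relation matrix $(a_{ij})_{s\times t}$, so that the symmetric algebra is $\operatorname{Sym} M=R[y_1,\ldots,y_t]/J$ with $J=(\sum_{j=1}^t a_{1j}y_j,\ldots,\sum_{j=1}^t a_{sj}y_j)$. Let $<$ be a monomial order on the monomials in $y_1,\ldots,y_t$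 with $y_1<\cdots<y_t$, and let $\operatorname{in}_<J$ be the ideal of $R[y_1,\ldots,y_t]$ generated by the initial terms (coefficient in $R$ times the largest monomial in $y_1,\ldots,y_t$) of the nonzero elements of $J$. Put $I_i=(g_1,\ldots,g_{i-1}):_R g_i$. Then $g_1,\ldots,g_t$ is an $s$-sequence with respect to $<$ if $(I_1y_1,\ldots,I_ty_t)=\operatorname{in}_<J$, and a strong $s$-sequence if in addition $I_1\subseteq\cdots\subseteq I_t$. In the claim these notions are applied with $R=S$, $M=I$ and $g_i=u_i$, and $<$ is the reverse lexicographic order with $y_1<\cdots<y_t$. Pretty clean: a (multigraded) prime filtration of a finitely generated multigraded $S$-module $N$ is a finite filtration $0=N_0\subset N_1\subset\cdots\subset N_r=N$ by multigraded submodules such that there are multigraded isomorphisms $N_i/N_{i-1}\cong S/\mathfrak{p}_i(-a_i)$ with $a_i\in\mathbb{Z}^n$ and $\mathfrak{p}_i$ a multigraded prime ideal of $S$. It is pretty clean if for all $i<j$ with $\mathfrak{p}_i\subseteq\mathfrak{p}_j$ one has $\mathfrak{p}_i=\mathfrak{p}_j$. The module $N$ is pretty clean if it admits a pretty clean filtration. *)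

theory Defs
  imports
    "HOL-Algebra.Algebra"
    "HOL-Algebra.Algebraic_Closure_Type"
    "HOL-Library.Poly_Mapping"
begin

text \<open>
  A commutative ring \<open>R\<close> is a type of class \<open>comm_ring_1\<close>; as a structure in the sense of
  HOL-Algebra it is \<open>ring_of_type_algebra\<close>. Modules over it are HOL-Algebra module records, whose
  ring multiplication fields are irrelevant and set to \<open>undefined\<close> below. Sequences are lists, so
  \<open>f\<^sub>1, \<dots>, f\<^sub>t\<close> are \<open>fs ! 0, \<dots>, fs ! (t - 1)\<close>, and \<open>take i fs\<close> is \<open>f\<^sub>1, \<dots>, f\<^sub>i\<close>.
\<close>

abbreviation ideal_gen :: "'r::comm_ring_1 set \<Rightarrow> 'r set" where
  "ideal_gen B \<equiv> Idl\<^bsub>ring_of_type_algebra\<^esub> B"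

section \<open>Modules\<close>

definition ring_module :: "('r::comm_ring_1, 'r) module" where
  "ring_module = \<lparr>carrier = UNIV, monoid.mult = undefined, one = undefined,
                  ring.zero = 0, add = (+), module.smult = (*)\<rparr>"

text \<open>The free module on a finite set \<open>B\<close>; the basis element \<open>e\<^sub>x\<close> is the indicator of \<open>x\<close>.\<close>

definition free_module :: "'x set \<Rightarrow> ('r::comm_ring_1, 'x \<Rightarrow> 'r) module" where
  "free_module B = \<lparr>carrier = {v. \<forall>x. x \<notin> B \<longrightarrow> v x = 0},
                    monoid.mult = undefined, one = undefined, ring.zero = (\<lambda>_. 0),
                    add = (\<lambda>v w x. v x + w x),
                    module.smult = (\<lambda>r v x. r * v x)\<rparr>"

definition submodule_gen :: "('r::comm_ring_1, 'm, 'z) module_scheme \<Rightarrow> 'm set \<Rightarrow> 'm set" where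
  "submodule_gen M B = \<Inter>{N. submodule N ring_of_type_algebra M \<and> B \<subseteq> N}"

definition quot_module ::
  "('r::comm_ring_1, 'm, 'z) module_scheme \<Rightarrow> 'm set \<Rightarrow> ('r, 'm set) module" where
  "quot_module M N = \<lparr>carrier = a_rcosets\<^bsub>M\<^esub> N, monoid.mult = undefined,
                      one = undefined, ring.zero = N, add = set_add M,
                      module.smult = (\<lambda>r C. \<Union>x\<in>C. N +>\<^bsub>M\<^esub> (r \<odot>\<^bsub>M\<^esub> x))\<rparr>"

text \<open>The colon ideal \<open>N :\<^sub>R g\<close>.\<close>

definition colon :: "('r::comm_ring_1, 'm, 'z) module_scheme \<Rightarrow> 'm set \<Rightarrow> 'm \<Rightarrow> 'r set" where
  "colon M N g = {r. r \<odot>\<^bsub>M\<^esub> g \<in> N}"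

section \<open>d-sequences\<close>

definition d_sequence :: "'r::comm_ring_1 list \<Rightarrow> bool" where
  "d_sequence fs \<longleftrightarrow>
     (\<forall>i<length fs. ideal_gen {fs ! j | j. j < length fs \<and> j \<noteq> i} \<noteq> ideal_gen (set fs)) \<and>
     (\<forall>i<length fs. \<forall>k. i \<le> k \<and> k < length fs \<longrightarrow>
        colon ring_module (ideal_gen (set (take i fs))) (fs ! i * fs ! k) =
        colon ring_module (ideal_gen (set (take i fs))) (fs ! k))"

section \<open>Proper sequences\<close>

text \<open>
  The Koszul complex of \<open>fs\<close> in degree \<open>j\<close> is free on the \<open>j\<close>-subsets \<open>A\<close> of the index set, with
  \<open>e\<^sub>A\<close> the wedge product of the \<open>e\<^sub>a\<close> in increasing order of \<open>a \<in> A\<close>. The differential sends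
  \<open>e\<^sub>A\<close> to the sum over \<open>a \<in> A\<close> of \<open>(-1) ^ card {b \<in> A. b < a} * (fs ! a)\<close> times the basis element
  of \<open>A - {a}\<close>; below it is written through the coefficient it has at \<open>B = A - {a}\<close>.
\<close>

definition koszul_module :: "'r::comm_ring_1 list \<Rightarrow> nat \<Rightarrow> ('r, nat set \<Rightarrow> 'r) module" where
  "koszul_module fs j = free_module {A. A \<subseteq> {..<length fs} \<and> card A = j}"

definition koszul_diff :: "'r::comm_ring_1 list \<Rightarrow> (nat set \<Rightarrow> 'r) \<Rightarrow> nat set \<Rightarrow> 'r" where
  "koszul_diff fs c =
     (\<lambda>B. \<Sum>a\<in>{..<length fs} - B. (-1) ^ card {b \<in> B. b < a} * fs ! a * c (insert a B))"

definition koszul_homology ::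
  "'r::comm_ring_1 list \<Rightarrow> nat \<Rightarrow> ('r, (nat set \<Rightarrow> 'r) set) module" where
  "koszul_homology fs j =
     quot_module
       ((koszul_module fs j)
          \<lparr>carrier := {z \<in> carrier (koszul_module fs j). koszul_diff fs z = (\<lambda>_. 0)}\<rparr>)
       (koszul_diff fs ` carrier (koszul_module fs (Suc j)))"

definition proper_sequence :: "'r::comm_ring_1 list \<Rightarrow> bool" where
  "proper_sequence fs \<longleftrightarrow>
     (\<forall>i<length fs. \<forall>j>0. \<forall>h\<in>carrier (koszul_homology (take i fs) j).
        fs ! i \<odot>\<^bsub>koszul_homology (take i fs) j\<^esub> h = \<zero>\<^bsub>koszul_homology (take i fs) j\<^esub>)"

section \<open>Strong s-sequences\<close>

text \<open>
  The ring \<open>R[y\<^sub>1, \<dots>, y\<^sub>t]\<close> consists of the polynomials in variables indexed by \<open>nat\<close> in which only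
  the variables with index less than \<open>t\<close> occur; ideals are taken inside this ring.
\<close>

definition y_ring :: "nat \<Rightarrow> ((nat \<Rightarrow>\<^sub>0 nat) \<Rightarrow>\<^sub>0 'r::comm_ring_1) ring" where
  "y_ring t = ring_of_type_algebra
     \<lparr>carrier := {p. \<forall>m\<in>Poly_Mapping.keys p. Poly_Mapping.keys m \<subseteq> {..<t}}\<rparr>"

abbreviation y_term :: "'r::comm_ring_1 \<Rightarrow> nat \<Rightarrow> (nat \<Rightarrow>\<^sub>0 nat) \<Rightarrow>\<^sub>0 'r" where
  "y_term r i \<equiv> Poly_Mapping.single (Poly_Mapping.single i 1) r"

definition relations :: "('r::comm_ring_1, 'm, 'z) module_scheme \<Rightarrow> 'm list \<Rightarrow> (nat \<Rightarrow> 'r) set" where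
  "relations M g = {v \<in> carrier (free_module {..<length g}).
     (\<Oplus>\<^bsub>M\<^esub>i\<in>{..<length g}. v i \<odot>\<^bsub>M\<^esub> (g ! i)) = \<zero>\<^bsub>M\<^esub>}"

text \<open>A matrix is given as the list of its rows.\<close>

definition relation_matrix ::
  "('r::comm_ring_1, 'm, 'z) module_scheme \<Rightarrow> 'm list \<Rightarrow> (nat \<Rightarrow> 'r) list \<Rightarrow> bool" where
  "relation_matrix M g rows \<longleftrightarrow>
     set rows \<subseteq> relations M g \<and>
     submodule_gen (free_module {..<length g}) (set rows) = relations M g"

definition sym_ideal :: "nat \<Rightarrow> (nat \<Rightarrow> 'r::comm_ring_1) list \<Rightarrow> ((nat \<Rightarrow>\<^sub>0 nat) \<Rightarrow>\<^sub>0 'r) set" where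
  "sym_ideal t rows = Idl\<^bsub>y_ring t\<^esub> ((\<lambda>a. \<Sum>j<t. y_term (a j) j) ` set rows)"

text \<open>Throughout, \<open>ls\<close> is the strict relation of a monomial order on the exponents of the \<open>y\<^sub>i\<close>.\<close>

definition leading_exponent ::
  "((nat \<Rightarrow>\<^sub>0 nat) \<Rightarrow> (nat \<Rightarrow>\<^sub>0 nat) \<Rightarrow> bool) \<Rightarrow>
   ((nat \<Rightarrow>\<^sub>0 nat) \<Rightarrow>\<^sub>0 'r::comm_ring_1) \<Rightarrow> (nat \<Rightarrow>\<^sub>0 nat) \<Rightarrow> bool" where
  "leading_exponent ls p m \<longleftrightarrow>
     m \<in> Poly_Mapping.keys p \<and> (\<forall>m'\<in>Poly_Mapping.keys p. m' \<noteq> m \<longrightarrow> ls m' m)"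

definition initial_ideal ::
  "((nat \<Rightarrow>\<^sub>0 nat) \<Rightarrow> (nat \<Rightarrow>\<^sub>0 nat) \<Rightarrow> bool) \<Rightarrow> nat \<Rightarrow>
   ((nat \<Rightarrow>\<^sub>0 nat) \<Rightarrow>\<^sub>0 'r::comm_ring_1) set \<Rightarrow> ((nat \<Rightarrow>\<^sub>0 nat) \<Rightarrow>\<^sub>0 'r) set" where
  "initial_ideal ls t J = Idl\<^bsub>y_ring t\<^esub>
     {Poly_Mapping.single m (Poly_Mapping.lookup p m) | p m. p \<in> J \<and> leading_exponent ls p m}"

definition annihilator_ideal ::
  "('r::comm_ring_1, 'm, 'z) module_scheme \<Rightarrow> 'm list \<Rightarrow> nat \<Rightarrow> 'r set" where
  "annihilator_ideal M g i = colon M (submodule_gen M (set (take i g))) (g ! i)"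

text \<open>
  The ideal \<open>J\<close> of the symmetric algebra is generated by the linear forms of all relations, so it
  does not depend on the choice of the relation matrix.
\<close>

definition s_sequence ::
  "((nat \<Rightarrow>\<^sub>0 nat) \<Rightarrow> (nat \<Rightarrow>\<^sub>0 nat) \<Rightarrow> bool) \<Rightarrow>
   ('r::comm_ring_1, 'm, 'z) module_scheme \<Rightarrow> 'm list \<Rightarrow> bool" where
  "s_sequence ls M g \<longleftrightarrow>
     set g \<subseteq> carrier M \<and> submodule_gen M (set g) = carrier M \<and>
     (\<exists>rows. relation_matrix M g rows \<and>
        Idl\<^bsub>y_ring (length g)\<^esub> {y_term r i | r i. i < length g \<and> r \<in> annihilator_ideal M g i} =
        initial_ideal ls (length g) (sym_ideal (length g) rows))"

definition strong_s_sequence ::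
  "((nat \<Rightarrow>\<^sub>0 nat) \<Rightarrow> (nat \<Rightarrow>\<^sub>0 nat) \<Rightarrow> bool) \<Rightarrow>
   ('r::comm_ring_1, 'm, 'z) module_scheme \<Rightarrow> 'm list \<Rightarrow> bool" where
  "strong_s_sequence ls M g \<longleftrightarrow> s_sequence ls M g \<and>
     (\<forall>i j. i \<le> j \<and> j < length g \<longrightarrow> annihilator_ideal M g i \<subseteq> annihilator_ideal M g j)"

text \<open>
  The (graded) reverse lexicographic order with \<open>y\<^sub>1 < \<dots> < y\<^sub>t\<close>: among monomials of equal degree,
  the smaller one has the larger exponent at the smallest variable where the two differ.
\<close>

definition revlex_less :: "(nat \<Rightarrow>\<^sub>0 nat) \<Rightarrow> (nat \<Rightarrow>\<^sub>0 nat) \<Rightarrow> bool" where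
  "revlex_less a b \<longleftrightarrow>
     (let deg = (\<lambda>m. \<Sum>i\<in>Poly_Mapping.keys m. Poly_Mapping.lookup m i) in
      deg a < deg b \<or>
      (deg a = deg b \<and>
       (\<exists>i. Poly_Mapping.lookup b i < Poly_Mapping.lookup a i \<and>
            (\<forall>j<i. Poly_Mapping.lookup a j = Poly_Mapping.lookup b j))))"

section \<open>Monomial ideals\<close>

text \<open>The polynomial ring \<open>K[x\<^sub>1, \<dots>, x\<^sub>n]\<close>, with \<open>n = CARD('n)\<close>.\<close>

type_synonym ('n, 'k) mpoly = "('n \<Rightarrow>\<^sub>0 nat) \<Rightarrow>\<^sub>0 'k"

definition monomials :: "('n, 'k::field) mpoly set" where
  "monomials = {Poly_Mapping.single m 1 | m. True}"

definition monomial_ideal :: "('n::finite, 'k::field) mpoly set \<Rightarrow> bool" where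
  "monomial_ideal I \<longleftrightarrow> (\<exists>B \<subseteq> monomials. I = ideal_gen B)"

definition minimal_monomial_generators ::
  "('n::finite, 'k::field) mpoly set \<Rightarrow> ('n, 'k) mpoly set \<Rightarrow> bool" where
  "minimal_monomial_generators I G \<longleftrightarrow>
     G \<subseteq> monomials \<and> ideal_gen G = I \<and> (\<forall>H. H \<subset> G \<longrightarrow> ideal_gen H \<noteq> I)"

section \<open>Multigraded modules and pretty cleanness\<close>

text \<open>
  A multigraded module is a module \<open>M\<close> together with the family \<open>D\<close> of its homogeneous components,
  indexed by \<open>\<int>\<^sup>n\<close>.
\<close>

definition multidegree :: "('n::finite \<Rightarrow> int) \<Rightarrow> ('n, 'k::field) mpoly set" where
  "multidegree b = {p. \<forall>m\<in>Poly_Mapping.keys p. \<forall>i. int (Poly_Mapping.lookup m i) = b i}"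

definition quot_grading ::
  "('r::comm_ring_1, 'm, 'z) module_scheme \<Rightarrow> 'm set \<Rightarrow> (('n \<Rightarrow> int) \<Rightarrow> 'm set) \<Rightarrow>
   ('n \<Rightarrow> int) \<Rightarrow> 'm set set" where
  "quot_grading M N D = (\<lambda>b. (\<lambda>x. N +>\<^bsub>M\<^esub> x) ` D b)"

text \<open>The grading of \<open>M(-a)\<close>.\<close>

definition shift_grading ::
  "('n \<Rightarrow> int) \<Rightarrow> (('n \<Rightarrow> int) \<Rightarrow> 'm set) \<Rightarrow> ('n \<Rightarrow> int) \<Rightarrow> 'm set" where
  "shift_grading a D = (\<lambda>b. D (\<lambda>i. b i - a i))"

definition multigraded_submodule ::
  "('r::comm_ring_1, 'm, 'z) module_scheme \<Rightarrow> (('n \<Rightarrow> int) \<Rightarrow> 'm set) \<Rightarrow> 'm set \<Rightarrow> bool" where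
  "multigraded_submodule M D N \<longleftrightarrow>
     submodule N ring_of_type_algebra M \<and> N = submodule_gen M (\<Union>b. N \<inter> D b)"

definition multigraded_iso ::
  "('r::comm_ring_1, 'm, 'z) module_scheme \<Rightarrow> (('n \<Rightarrow> int) \<Rightarrow> 'm set) \<Rightarrow>
   ('r, 'l, 'y) module_scheme \<Rightarrow> (('n \<Rightarrow> int) \<Rightarrow> 'l set) \<Rightarrow> bool" where
  "multigraded_iso M D M' D' \<longleftrightarrow>
     (\<exists>\<phi>. bij_betw \<phi> (carrier M) (carrier M') \<and>
          (\<forall>x\<in>carrier M. \<forall>y\<in>carrier M. \<phi> (x \<oplus>\<^bsub>M\<^esub> y) = \<phi> x \<oplus>\<^bsub>M'\<^esub> \<phi> y) \<and>
          (\<forall>r. \<forall>x\<in>carrier M. \<phi> (r \<odot>\<^bsub>M\<^esub> x) = r \<odot>\<^bsub>M'\<^esub> \<phi> x) \<and>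
          (\<forall>b. \<phi> ` D b = D' b))"

definition prime_filtration ::
  "(('n::finite, 'k::field) mpoly, 'm, 'z) module_scheme \<Rightarrow> (('n \<Rightarrow> int) \<Rightarrow> 'm set) \<Rightarrow>
   nat \<Rightarrow> (nat \<Rightarrow> 'm set) \<Rightarrow> (nat \<Rightarrow> ('n, 'k) mpoly set) \<Rightarrow> (nat \<Rightarrow> 'n \<Rightarrow> int) \<Rightarrow> bool" where
  "prime_filtration M D r N \<pp> a \<longleftrightarrow>
     N 0 = {\<zero>\<^bsub>M\<^esub>} \<and> N r = carrier M \<and>
     (\<forall>i\<le>r. multigraded_submodule M D (N i)) \<and>
     (\<forall>i\<in>{1..r}.
        N (i - 1) \<subset> N i \<and>
        primeideal (\<pp> i) ring_of_type_algebra \<and>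
        multigraded_submodule ring_module multidegree (\<pp> i) \<and>
        multigraded_iso
          (quot_module (M\<lparr>carrier := N i\<rparr>) (N (i - 1)))
          (quot_grading M (N (i - 1)) (\<lambda>b. N i \<inter> D b))
          (quot_module ring_module (\<pp> i))
          (shift_grading (a i) (quot_grading ring_module (\<pp> i) multidegree)))"

definition pretty_clean ::
  "(('n::finite, 'k::field) mpoly, 'm, 'z) module_scheme \<Rightarrow> (('n \<Rightarrow> int) \<Rightarrow> 'm set) \<Rightarrow> bool" where
  "pretty_clean M D \<longleftrightarrow>
     (\<exists>r N \<pp> a. prime_filtration M D r N \<pp> a \<and>
        (\<forall>i\<in>{1..r}. \<forall>j\<in>{1..r}. i < j \<and> \<pp> i \<subseteq> \<pp> j \<longrightarrow> \<pp> i = \<pp> j))"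

end

theory Submission
  imports Defs "HOL-Library.Function_Algebras"
begin

text \<open>
  The three hypotheses have a common consequence, called \<open>colon_stable\<close> below: for \<open>j < k\<close> the colon
  ideal \<open>(u\<^sub>1, \<dots>, u\<^sub>j\<^sub>-\<^sub>1) : u\<^sub>j\<close> is contained in \<open>(u\<^sub>1, \<dots>, u\<^sub>j\<^sub>-\<^sub>1) : u\<^sub>k\<close>. It holds over every commutative
  ring. For a d-sequence it is immediate. For a proper sequence, an element \<open>r\<close> of the first ideal
  is the last coefficient of a syzygy of \<open>u\<^sub>1, \<dots>, u\<^sub>j\<close>; the first homology of \<open>u\<^sub>1, \<dots>, u\<^sub>j\<close> embeds into that of
  \<open>u\<^sub>1, \<dots>, u\<^sub>k\<^sub>-\<^sub>1\<close>, where \<open>u\<^sub>k\<close> acts as zero, so \<open>u\<^sub>k\<close> times the syzygy is a Koszul boundary, and its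
  last coefficient lies in \<open>(u\<^sub>1, \<dots>, u\<^sub>j\<^sub>-\<^sub>1)\<close>. For a strong s-sequence, the linear forms in \<open>J\<close> with
  leading terms \<open>r y\<^sub>j\<close> and \<open>r y\<^sub>k\<close> give a quadric in \<open>J\<close> without the term \<open>r y\<^sub>j y\<^sub>k\<close>; reading off its
  leading coefficients successively removes \<open>u\<^sub>k\<^sub>-\<^sub>1, \<dots>, u\<^sub>j\<close> from an expression of \<open>r u\<^sub>k\<close>.

  For the minimal monomial generators of an ideal, \<open>colon_stable\<close> forces \<open>gcd(u\<^sub>i, u\<^sub>j)\<close> to divide
  \<open>u\<^sub>k\<close> whenever \<open>i < j < k\<close> (\<open>gcd_divides_later\<close>). From here on only this divisibility matters, and it
  is inherited when all the monomials are divided, as far as possible, by a common monomial \<open>v\<close>,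
  that is, when the ideal \<open>I\<close> is replaced by \<open>I : v\<close>.

  The filtration of \<open>S/I\<close> comes from the exact sequences
  \<open>0 \<rightarrow> S/(I : v)(-v) \<rightarrow> S/I \<rightarrow> S/(I, v) \<rightarrow> 0\<close>. Suppose the first \<open>s\<close> generators are pairwise coprime
  and the next one, \<open>w\<close>, is not coprime to one of them, \<open>a\<close>. Take \<open>v = gcd(a, w)\<close>. All generators
  after \<open>w\<close> are divisible by \<open>v\<close>, so \<open>(I, v)\<close> is generated by \<open>v\<close> and the \<open>s - 1\<close> other coprime
  generators: it is a complete intersection, and all its primes have height \<open>s\<close>. The ideal \<open>I : v\<close>
  is of the same kind as \<open>I\<close>, with \<open>s\<close> coprime generators at the front, so by induction its primes have
  height at least \<open>s\<close>. Hence the heights of the primes never increase along the filtration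
  (\<open>prime_filt_gcd_chain\<close>). Such a filtration is pretty clean, because a proper inclusion of primes
  generated by variables increases the height (\<open>pretty_clean_prime_filt\<close>).

  Indices start at \<open>0\<close> in the formal text, and monomial ideals are handled through the sets of
  exponents of their monomials, with exponents as functions to \<open>nat\<close> under the pointwise order.
\<close>

section \<open>Modules and ideals of a commutative ring\<close>

abbreviation type_ring :: "'r::comm_ring_1 ring" where "type_ring \<equiv> ring_of_type_algebra"

lemma type_ring_simps [simp]:
  "carrier type_ring = UNIV" "x \<otimes>\<^bsub>type_ring\<^esub> y = x * y" "x \<oplus>\<^bsub>type_ring\<^esub> y = x + y"
  "\<zero>\<^bsub>type_ring\<^esub> = 0" "\<one>\<^bsub>type_ring\<^esub> = 1"
  by (simp_all add: ring_of_type_algebra_def)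

lemma type_ring_a_inv [simp]: "\<ominus>\<^bsub>type_ring\<^esub> x = - (x :: 'r::comm_ring_1)"
proof -
  interpret ring "type_ring :: 'r ring" by (rule ring_from_type_algebra)
  show ?thesis using minus_equality[of "- x" x] by simp
qed

definition is_ideal :: "'r::comm_ring_1 set \<Rightarrow> bool" where
  "is_ideal I \<longleftrightarrow> 0 \<in> I \<and> (\<forall>x\<in>I. \<forall>y\<in>I. x + y \<in> I) \<and> (\<forall>r. \<forall>x\<in>I. r * x \<in> I)"

lemma is_idealD:
  assumes "is_ideal I"
  shows "0 \<in> I" "x \<in> I \<Longrightarrow> y \<in> I \<Longrightarrow> x + y \<in> I" "x \<in> I \<Longrightarrow> r * x \<in> I"
    "x \<in> I \<Longrightarrow> - x \<in> I" "x \<in> I \<Longrightarrow> y \<in> I \<Longrightarrow> x - y \<in> I"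
proof -
  show 1: "0 \<in> I" "x \<in> I \<Longrightarrow> y \<in> I \<Longrightarrow> x + y \<in> I" "x \<in> I \<Longrightarrow> r * x \<in> I" for x y r
    using assms by (auto simp: is_ideal_def)
  show 2: "x \<in> I \<Longrightarrow> - x \<in> I" for x using 1(3)[of x "- 1"] by simp
  show "x \<in> I \<Longrightarrow> y \<in> I \<Longrightarrow> x - y \<in> I" using 1(2)[of x "- y"] 2[of y] by simp
qed

lemma is_ideal_sum: "is_ideal I \<Longrightarrow> (\<And>x. x \<in> A \<Longrightarrow> f x \<in> I) \<Longrightarrow> sum f A \<in> I"
  by (induction A rule: infinite_finite_induct) (auto simp: is_idealD)

text \<open>
  The axiom for \<open>(- 1) x + x\<close> replaces the existence of negatives, so that all the conditions are
  equations between elements at hand.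
\<close>

lemma module_typeI:
  fixes M :: "('r::comm_ring_1, 'm, 'z) module_scheme"
  assumes "\<And>x y. x \<in> carrier M \<Longrightarrow> y \<in> carrier M \<Longrightarrow> x \<oplus>\<^bsub>M\<^esub> y \<in> carrier M"
    and "\<zero>\<^bsub>M\<^esub> \<in> carrier M"
    and "\<And>x y z. x \<in> carrier M \<Longrightarrow> y \<in> carrier M \<Longrightarrow> z \<in> carrier M \<Longrightarrow>
      (x \<oplus>\<^bsub>M\<^esub> y) \<oplus>\<^bsub>M\<^esub> z = x \<oplus>\<^bsub>M\<^esub> (y \<oplus>\<^bsub>M\<^esub> z)"
    and "\<And>x y. x \<in> carrier M \<Longrightarrow> y \<in> carrier M \<Longrightarrow> x \<oplus>\<^bsub>M\<^esub> y = y \<oplus>\<^bsub>M\<^esub> x"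
    and "\<And>x. x \<in> carrier M \<Longrightarrow> \<zero>\<^bsub>M\<^esub> \<oplus>\<^bsub>M\<^esub> x = x"
    and "\<And>r x. x \<in> carrier M \<Longrightarrow> r \<odot>\<^bsub>M\<^esub> x \<in> carrier M"
    and "\<And>x. x \<in> carrier M \<Longrightarrow> (- 1) \<odot>\<^bsub>M\<^esub> x \<oplus>\<^bsub>M\<^esub> x = \<zero>\<^bsub>M\<^esub>"
    and "\<And>r s x. x \<in> carrier M \<Longrightarrow> (r + s) \<odot>\<^bsub>M\<^esub> x = r \<odot>\<^bsub>M\<^esub> x \<oplus>\<^bsub>M\<^esub> s \<odot>\<^bsub>M\<^esub> x"
    and "\<And>r x y. x \<in> carrier M \<Longrightarrow> y \<in> carrier M \<Longrightarrow>
      r \<odot>\<^bsub>M\<^esub> (x \<oplus>\<^bsub>M\<^esub> y) = r \<odot>\<^bsub>M\<^esub> x \<oplus>\<^bsub>M\<^esub> r \<odot>\<^bsub>M\<^esub> y"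
    and "\<And>r s x. x \<in> carrier M \<Longrightarrow> (r * s) \<odot>\<^bsub>M\<^esub> x = r \<odot>\<^bsub>M\<^esub> (s \<odot>\<^bsub>M\<^esub> x)"
    and "\<And>x. x \<in> carrier M \<Longrightarrow> 1 \<odot>\<^bsub>M\<^esub> x = x"
  shows "module type_ring M"
proof (rule moduleI)
  show "cring (type_ring :: 'r ring)" by (rule cring_from_type_algebra)
  show "abelian_group M"
  proof (rule abelian_groupI)
    fix x assume "x \<in> carrier M"
    then show "\<exists>y\<in>carrier M. y \<oplus>\<^bsub>M\<^esub> x = \<zero>\<^bsub>M\<^esub>" using assms(6,7) by blast
  qed (rule assms; assumption)+
qed (simp_all add: assms(6,8-11))

text \<open>
  Closure under negation, which is part of being a submodule, follows from closure under
  multiplication by \<open>- 1\<close>.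
\<close>

lemma submodule_iff:
  fixes M :: "('r::comm_ring_1, 'm, 'z) module_scheme"
  assumes "module type_ring M"
  shows "submodule N type_ring M \<longleftrightarrow> N \<subseteq> carrier M \<and> \<zero>\<^bsub>M\<^esub> \<in> N \<and>
    (\<forall>x\<in>N. \<forall>y\<in>N. x \<oplus>\<^bsub>M\<^esub> y \<in> N) \<and> (\<forall>r. \<forall>x\<in>N. r \<odot>\<^bsub>M\<^esub> x \<in> N)" (is "?L \<longleftrightarrow> ?R")
proof
  interpret module type_ring M by (rule assms)
  assume ?L
  have "\<zero>\<^bsub>M\<^esub> \<in> N" using subgroup.one_closed[OF submodule.axioms(1)[OF \<open>?L\<close>]] by simp
  then show ?R using submoduleE[OF \<open>?L\<close>] by simp
next
  interpret module type_ring M by (rule assms)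
  assume ?R
  show ?L
  proof (rule submoduleI)
    fix x assume "x \<in> N"
    then have x: "x \<in> carrier M" using \<open>?R\<close> by blast
    have "(- 1) \<odot>\<^bsub>M\<^esub> x = \<ominus>\<^bsub>M\<^esub> x"
      using smult_l_minus[of 1 x] smult_one[OF x] x by simp
    moreover have "(- 1) \<odot>\<^bsub>M\<^esub> x \<in> N" using \<open>?R\<close> \<open>x \<in> N\<close> by blast
    ultimately show "\<ominus>\<^bsub>M\<^esub> x \<in> N" by simp
  qed (use \<open>?R\<close> in auto)
qed

lemma ideal_type_iff: "ideal I type_ring \<longleftrightarrow> is_ideal (I :: 'r::comm_ring_1 set)"
proof
  assume "ideal I type_ring"
  then interpret ideal I type_ring .
  show "is_ideal I" 
    using additive_subgroup.zero_closed[OF is_additive_subgroup]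
      additive_subgroup.a_closed[OF is_additive_subgroup] I_l_closed
    by (auto simp: is_ideal_def)
next
  assume I: "is_ideal I"
  interpret ring "type_ring :: 'r ring" by (rule ring_from_type_algebra)
  show "ideal I type_ring"
  proof (rule idealI)
    show "ring (type_ring :: 'r ring)" by (rule ring_from_type_algebra)
    show "subgroup I (add_monoid (type_ring :: 'r ring))"
    proof (rule add.subgroupI)
      show "I \<noteq> {}" using is_idealD(1)[OF I] by blast
      fix a assume "a \<in> I"
      then show "\<ominus>\<^bsub>type_ring\<^esub> a \<in> I"
        using is_idealD(4)[OF I, of a] by simp
    qed (use is_idealD[OF I] in auto)
  qed (use is_idealD[OF I] in \<open>auto simp: mult.commute\<close>)
qed

lemma ideal_gen_ideal: "is_ideal (ideal_gen (B :: 'r::comm_ring_1 set))"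
proof -
  interpret ring "type_ring :: 'r ring" by (rule ring_from_type_algebra)
  show ?thesis using genideal_ideal[of B] by (simp add: ideal_type_iff)
qed

lemma ideal_gen_subset: "B \<subseteq> ideal_gen B"
  by (auto simp: genideal_def)

lemma ideal_gen_least: "is_ideal I \<Longrightarrow> B \<subseteq> I \<Longrightarrow> ideal_gen B \<subseteq> I"
  by (auto simp: genideal_def ideal_type_iff)

abbreviation prefix_ideal :: "'r::comm_ring_1 list \<Rightarrow> nat \<Rightarrow> 'r set" where
  "prefix_ideal fs i \<equiv> ideal_gen (set (take i fs))"

lemma prefix_ideal_iff:
  assumes "i \<le> length fs"
  shows "x \<in> prefix_ideal fs i \<longleftrightarrow> (\<exists>c. x = (\<Sum>l<i. c l * fs ! l))"
proof
  define T where "T = {x. \<exists>c. x = (\<Sum>l<i. c l * fs ! l)}"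
  have "is_ideal T"
    unfolding is_ideal_def
  proof (intro conjI ballI allI)
    show "0 \<in> T" unfolding T_def by (rule CollectI, rule exI[of _ "\<lambda>_. 0"]) simp
    fix x r assume "x \<in> T"
    then obtain c where c: "x = (\<Sum>l<i. c l * fs ! l)" by (auto simp: T_def)
    show "r * x \<in> T" unfolding T_def c
      by (rule CollectI, rule exI[of _ "\<lambda>l. r * c l"]) (simp add: sum_distrib_left mult.assoc)
    fix y assume "y \<in> T"
    then obtain d where d: "y = (\<Sum>l<i. d l * fs ! l)" by (auto simp: T_def)
    show "x + y \<in> T" unfolding T_def c d
      by (rule CollectI, rule exI[of _ "\<lambda>l. c l + d l"]) (simp add: sum.distrib distrib_right)
  qed
  moreover have "set (take i fs) \<subseteq> T"
  proof
    fix x assume "x \<in> set (take i fs)"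
    then obtain m where m: "m < i" "x = fs ! m" using assms by (auto simp: in_set_conv_nth)
    then have "x = (\<Sum>l<i. (if l = m then 1 else 0) * fs ! l)"
      by (simp add: if_distrib[of "\<lambda>u. u * _"] sum.delta cong: if_cong)
    then show "x \<in> T" unfolding T_def by (intro CollectI exI[of _ "\<lambda>l. if l = m then 1 else 0"])
  qed
  ultimately have "prefix_ideal fs i \<subseteq> T" by (rule ideal_gen_least)
  then show "x \<in> prefix_ideal fs i \<Longrightarrow> \<exists>c. x = (\<Sum>l<i. c l * fs ! l)" by (auto simp: T_def)
next
  assume "\<exists>c. x = (\<Sum>l<i. c l * fs ! l)"
  then obtain c where c: "x = (\<Sum>l<i. c l * fs ! l)" by blast
  have "fs ! l \<in> prefix_ideal fs i" if "l < i" for l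
    using that assms ideal_gen_subset[of "set (take i fs)"] by (force simp: in_set_conv_nth)
  then show "x \<in> prefix_ideal fs i" unfolding c
    by (intro is_ideal_sum is_idealD(3)) (auto intro: ideal_gen_ideal)
qed

section \<open>A condition on colon ideals: d-sequences and proper sequences\<close>

text \<open>
  The consequence shared by the three kinds of sequences:
  \<open>(f\<^sub>1, \<dots>, f\<^sub>j\<^sub>-\<^sub>1) : f\<^sub>j \<subseteq> (f\<^sub>1, \<dots>, f\<^sub>j\<^sub>-\<^sub>1) : f\<^sub>k\<close> for \<open>j < k\<close>.
\<close>

definition colon_stable :: "'r::comm_ring_1 list \<Rightarrow> bool" where
  "colon_stable fs \<longleftrightarrow> (\<forall>k<length fs. \<forall>j<k. \<forall>r.
     r * fs ! j \<in> prefix_ideal fs j \<longrightarrow> r * fs ! k \<in> prefix_ideal fs j)"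

lemma d_sequence_colon_stable:
  assumes "d_sequence fs"
  shows "colon_stable fs"
  unfolding colon_stable_def
proof (intro allI impI)
  fix k j r assume jk: "k < length fs" "j < k" and r: "r * fs ! j \<in> prefix_ideal fs j"
  have "colon ring_module (prefix_ideal fs j) (fs ! j * fs ! k) =
      colon ring_module (prefix_ideal fs j) (fs ! k)"
    using assms jk by (auto simp: d_sequence_def)
  moreover have "r * (fs ! j * fs ! k) \<in> prefix_ideal fs j"
    using is_idealD(3)[OF ideal_gen_ideal r, of "fs ! k"] by (simp add: algebra_simps)
  ultimately show "r * fs ! k \<in> prefix_ideal fs j"
    by (auto simp: colon_def ring_module_def)
qed

lemma a_r_coset_eq: "N +>\<^bsub>M\<^esub> x = (\<lambda>n. n \<oplus>\<^bsub>M\<^esub> x) ` N"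
  by (auto simp: a_r_coset_def r_coset_def)

text \<open>
  The case \<open>j = 1\<close> of properness in coordinates. A syzygy \<open>z\<close> of \<open>f\<^sub>1, \<dots>, f\<^sub>i\<close> is a \<open>1\<close>-cycle, and
  \<open>f\<^sub>i\<^sub>+\<^sub>1 z\<close> is then a \<open>1\<close>-boundary. The \<open>2\<close>-chain that bounds it is written as the alternating matrix
  \<open>e\<close>, which absorbs the signs of the Koszul differential.
\<close>

lemma proper_sequence_syzygy:
  assumes proper: "proper_sequence fs" and i: "i < length fs"
    and z: "(\<Sum>a<i. z a * fs ! a) = 0"
  shows "\<exists>e. (\<forall>a b. e a b = - e b a) \<and> (\<forall>a. e a a = 0) \<and>
    (\<forall>b<i. fs ! i * z b = (\<Sum>a<i. e a b * fs ! a))"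
proof -
  define gs where "gs = take i fs"
  have len: "length gs = i" using i by (simp add: gs_def)
  have nth: "gs ! a = fs ! a" if "a < i" for a using that by (simp add: gs_def)
  (* The function z as a chain supported on singletons. *)
  define Z where "Z A = (if A \<subseteq> {..<i} \<and> card A = 1 then z (the_elem A) else 0)" for A
  have "koszul_diff gs Z B = 0" for B
  proof (cases "B = {}")
    case True
    then show ?thesis using z by (simp add: koszul_diff_def len nth Z_def mult.commute)
  next
    case False
    have "Z (insert a B) = 0" if "a \<notin> B" for a
    proof (cases "finite B")
      case True
      then show ?thesis using False that by (simp add: Z_def)
    qed (simp add: Z_def)
    then show ?thesis by (simp add: koszul_diff_def)
  qed
  define M where "M = (koszul_module gs 1)
          \<lparr>carrier := {z \<in> carrier (koszul_module gs 1). koszul_diff gs z = (\<lambda>_. 0)}\<rparr>"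
  define N where "N = koszul_diff gs ` carrier (koszul_module gs (Suc 1))"
  have H: "koszul_homology gs 1 = quot_module M N" by (simp add: koszul_homology_def M_def N_def)
  have Z: "Z \<in> carrier M" using \<open>\<And>B. koszul_diff gs Z B = 0\<close>
    by (auto simp: M_def koszul_module_def free_module_def Z_def len)
  have N0: "(\<lambda>_. 0) \<in> N" unfolding N_def
    by (rule image_eqI[of _ _ "\<lambda>_. 0"]) (auto simp: koszul_diff_def koszul_module_def free_module_def)
  have add: "v \<oplus>\<^bsub>M\<^esub> w = (\<lambda>x. v x + w x)" "r \<odot>\<^bsub>M\<^esub> v = (\<lambda>x. r * v x)" for v w r
    by (simp_all add: M_def koszul_module_def free_module_def)
  have "N +>\<^bsub>M\<^esub> Z \<in> carrier (quot_module M N)"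
    using Z by (auto simp: quot_module_def A_RCOSETS_def RCOSETS_def a_r_coset_def)
  then have "fs ! i \<odot>\<^bsub>quot_module M N\<^esub> (N +>\<^bsub>M\<^esub> Z) = N"
    using proper[unfolded proper_sequence_def, rule_format, OF i, of 1] H
    by (simp add: gs_def[symmetric]) (simp add: quot_module_def)
  then have eq: "(\<Union>x\<in>N +>\<^bsub>M\<^esub> Z. N +>\<^bsub>M\<^esub> (fs ! i \<odot>\<^bsub>M\<^esub> x)) = N"
    by (simp add: quot_module_def)
  have "Z \<in> N +>\<^bsub>M\<^esub> Z" using N0 by (force simp: a_r_coset_eq add)
  moreover have "(\<lambda>x. fs ! i * Z x) \<in> N +>\<^bsub>M\<^esub> (fs ! i \<odot>\<^bsub>M\<^esub> Z)"
    using N0 by (force simp: a_r_coset_eq add)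
  ultimately have "(\<lambda>x. fs ! i * Z x) \<in> N" using eq by blast
  then obtain c where c: "c \<in> carrier (koszul_module gs (Suc 1))"
    "(\<lambda>x. fs ! i * Z x) = koszul_diff gs c" by (auto simp: N_def)
  define e where "e a b = (if a = b then 0 else if b < a then - c {a, b} else c {a, b})" for a b
  have "fs ! i * z b = (\<Sum>a<i. e a b * fs ! a)" if b: "b < i" for b
  proof -
    have "fs ! i * z b = koszul_diff gs c {b}"
      using fun_cong[OF c(2), of "{b}"] b by (simp add: Z_def)
    also have "\<dots> = (\<Sum>a\<in>{..<i} - {b}. e a b * fs ! a)"
      unfolding koszul_diff_def len
    proof (rule sum.cong[OF refl])
      fix a assume a: "a \<in> {..<i} - {b}"
      have "{b' \<in> {b}. b' < a} = (if b < a then {b} else {})" by auto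
      then show "(- 1) ^ card {b' \<in> {b}. b' < a} * gs ! a * c (insert a {b}) = e a b * fs ! a"
        using a by (simp add: e_def nth mult.commute)
    qed
    also have "\<dots> = (\<Sum>a<i. e a b * fs ! a)"
      using b by (simp add: sum.remove[of "{..<i}" b] e_def)
    finally show ?thesis .
  qed
  then show ?thesis
    by (intro exI[of _ e]) (auto simp: e_def insert_commute)
qed

text \<open>
  Write \<open>r f\<^sub>j = \<Sum> c\<^sub>l f\<^sub>l\<close> as a syzygy \<open>z\<close> of \<open>f\<^sub>1, \<dots>, f\<^sub>j\<close>, extended by zero. By properness \<open>f\<^sub>k z\<close> is a
  boundary for \<open>f\<^sub>1, \<dots>, f\<^sub>k\<^sub>-\<^sub>1\<close>. It remains one for fewer and fewer elements, down to \<open>f\<^sub>1, \<dots>, f\<^sub>j\<close>: this is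
  the injectivity of \<open>H\<^sub>1(f\<^sub>1, \<dots>, f\<^sub>m) \<rightarrow> H\<^sub>1(f\<^sub>1, \<dots>, f\<^sub>m\<^sub>+\<^sub>1)\<close>, whose kernel is \<open>f\<^sub>m\<^sub>+\<^sub>1 H\<^sub>1(f\<^sub>1, \<dots>, f\<^sub>m) = 0\<close>. The
  coordinate of \<open>f\<^sub>k z\<close> at \<open>j\<close> is \<open>r f\<^sub>k\<close>, and a boundary for \<open>f\<^sub>1, \<dots>, f\<^sub>j\<close> has it in \<open>(f\<^sub>1, \<dots>, f\<^sub>j\<^sub>-\<^sub>1)\<close>.
\<close>

lemma proper_sequence_colon_stable:
  assumes proper: "proper_sequence fs"
  shows "colon_stable fs"
  unfolding colon_stable_def
proof (intro allI impI)
  fix k j r assume jk: "k < length fs" "j < k" and r: "r * fs ! j \<in> prefix_ideal fs j"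
  then obtain c where c: "r * fs ! j = (\<Sum>l<j. c l * fs ! l)"
    by (auto simp: prefix_ideal_iff)
  define z where "z l = (if l < j then - c l else if l = j then r else 0)" for l
  have z: "(\<Sum>a<k. z a * fs ! a) = 0"
  proof -
    have "(\<Sum>a<k. z a * fs ! a) = (\<Sum>a<Suc j. z a * fs ! a)"
      by (rule sum.mono_neutral_right) (use jk in \<open>auto simp: z_def\<close>)
    also have "\<dots> = 0" by (simp add: z_def c sum_negf)
    finally show ?thesis .
  qed
  have "\<exists>e. (\<forall>a b. e a b = - e b a) \<and> (\<forall>a. e a a = 0) \<and>
    (\<forall>b<Suc j. fs ! k * z b = (\<Sum>a<Suc j. e a b * fs ! a))"
  proof (rule inc_induct[of "Suc j" k])
    show "Suc j \<le> k" using jk by simp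
    show "\<exists>e. (\<forall>a b. e a b = - e b a) \<and> (\<forall>a. e a a = 0) \<and>
      (\<forall>b<k. fs ! k * z b = (\<Sum>a<k. e a b * fs ! a))"
      by (rule proper_sequence_syzygy[OF proper jk(1) z])
  next
    fix m assume m: "Suc j \<le> m" "m < k" and "\<exists>e. (\<forall>a b. e a b = - e b a) \<and> (\<forall>a. e a a = 0) \<and>
      (\<forall>b<Suc m. fs ! k * z b = (\<Sum>a<Suc m. e a b * fs ! a))"
    then obtain e where e: "\<forall>a b. e a b = - e b a" "\<forall>a. e a a = 0"
      "\<forall>b<Suc m. fs ! k * z b = (\<Sum>a<Suc m. e a b * fs ! a)" by (elim exE conjE)
    note e = e[rule_format]
    (* Column m of e is a syzygy of the first m elements, because z vanishes at m. *)
    have "(\<Sum>a<m. e a m * fs ! a) = 0"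
      using e(3)[of m] m by (simp add: z_def e(2))
    moreover have "m < length fs" using m jk by simp
    ultimately have "\<exists>d. (\<forall>a b. d a b = - d b a) \<and> (\<forall>a. d a a = 0) \<and>
      (\<forall>b<m. fs ! m * e b m = (\<Sum>a<m. d a b * fs ! a))"
      by (intro proper_sequence_syzygy[OF proper])
    then obtain d where d: "\<forall>a b. d a b = - d b a" "\<forall>a. d a a = 0"
      "\<forall>b<m. fs ! m * e b m = (\<Sum>a<m. d a b * fs ! a)" by (elim exE conjE)
    note d = d[rule_format]
    have "fs ! k * z b = (\<Sum>a<m. (e a b - d a b) * fs ! a)" if "b < m" for b
    proof -
      have "fs ! k * z b = (\<Sum>a<m. e a b * fs ! a) + e m b * fs ! m"
        using e(3)[of b] that by simp
      also have "e m b * fs ! m = - (\<Sum>a<m. d a b * fs ! a)"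
        using d(3)[OF that] e(1)[of m b] by (simp add: mult.commute)
      finally show ?thesis by (simp add: left_diff_distrib sum_subtractf)
    qed
    moreover have "e a b - d a b = - (e b a - d b a)" for a b
      by (subst e(1), subst d(1)) simp
    moreover have "e a a - d a a = 0" for a by (simp add: e(2) d(2))
    ultimately show "\<exists>e. (\<forall>a b. e a b = - e b a) \<and> (\<forall>a. e a a = 0) \<and>
      (\<forall>b<m. fs ! k * z b = (\<Sum>a<m. e a b * fs ! a))"
      by (intro exI[of _ "\<lambda>a b. e a b - d a b"] conjI allI impI)
  qed
  then obtain e where "\<forall>a b. e a b = - e b a" and e: "\<forall>a. e a a = 0"
    "\<forall>b<Suc j. fs ! k * z b = (\<Sum>a<Suc j. e a b * fs ! a)" by (elim exE conjE)
  have "e j j = 0" "fs ! k * z j = (\<Sum>a<Suc j. e a j * fs ! a)" using e by auto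
  then have "r * fs ! k = (\<Sum>a<j. e a j * fs ! a)" by (simp add: z_def mult.commute)
  then show "r * fs ! k \<in> prefix_ideal fs j" using jk by (auto simp: prefix_ideal_iff)
qed

section \<open>Strong s-sequences satisfy the condition\<close>

lemma module_ring_module: 
  assumes "is_ideal I" 
  shows "module type_ring (ring_module\<lparr>carrier := I\<rparr>)"
  by (rule module_typeI) (use assms in \<open>auto simp: ring_module_def algebra_simps is_idealD\<close>)

lemma submodule_gen_ideal:
  assumes "is_ideal I" "B \<subseteq> I"
  shows "submodule_gen (ring_module\<lparr>carrier := I\<rparr>) B = ideal_gen B"
proof -
  have sub: "submodule N type_ring (ring_module\<lparr>carrier := I\<rparr>) \<longleftrightarrow> N \<subseteq> I \<and> is_ideal N" for N
    unfolding submodule_iff[OF module_ring_module[OF assms(1)]] is_ideal_def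
    by (auto simp: ring_module_def)
  show ?thesis
  proof
    show "submodule_gen (ring_module\<lparr>carrier := I\<rparr>) B \<subseteq> ideal_gen B"
      unfolding submodule_gen_def sub
      using ideal_gen_subset ideal_gen_least[OF assms] ideal_gen_ideal by blast
    show "ideal_gen B \<subseteq> submodule_gen (ring_module\<lparr>carrier := I\<rparr>) B"
      unfolding submodule_gen_def sub using ideal_gen_least by blast
  qed
qed

lemma module_free_module: "module type_ring (free_module B)"
  by (rule module_typeI) (auto simp: free_module_def algebra_simps)

lemma finsum_ring_module:
  assumes "is_ideal I" "finite A" "\<And>x. x \<in> A \<Longrightarrow> f x \<in> I"
  shows "(\<Oplus>\<^bsub>ring_module\<lparr>carrier := I\<rparr>\<^esub>x\<in>A. f x) = sum f A"
proof -
  interpret module type_ring "ring_module\<lparr>carrier := I\<rparr>" by (rule module_ring_module[OF assms(1)])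
  show ?thesis using assms(2,3)
  proof (induction A)
    case empty
    show ?case by (simp add: M.finsum_empty) (simp add: ring_module_def)
  next
    case (insert x A)
    then have "f \<in> A \<rightarrow> carrier (ring_module\<lparr>carrier := I\<rparr>)" "f x \<in> carrier (ring_module\<lparr>carrier := I\<rparr>)"
      by auto
    then show ?case using insert M.finsum_insert[of A x f] by (simp) (simp add: ring_module_def)
  qed
qed

definition y_carrier :: "nat \<Rightarrow> ((nat \<Rightarrow>\<^sub>0 nat) \<Rightarrow>\<^sub>0 'r::comm_ring_1) set" where
  "y_carrier t = {p. \<forall>m\<in>Poly_Mapping.keys p. Poly_Mapping.keys m \<subseteq> {..<t}}"

lemma y_ring_eq: "y_ring t = type_ring\<lparr>carrier := y_carrier t\<rparr>"
  by (simp add: y_ring_def y_carrier_def)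

lemma y_ring_simps [simp]:
  "carrier (y_ring t) = y_carrier t" "x \<otimes>\<^bsub>y_ring t\<^esub> y = x * y" "x \<oplus>\<^bsub>y_ring t\<^esub> y = x + y"
  "\<zero>\<^bsub>y_ring t\<^esub> = 0" "\<one>\<^bsub>y_ring t\<^esub> = 1"
  by (simp_all add: y_ring_eq)

lemma y_carrier_add: "p \<in> y_carrier t \<Longrightarrow> q \<in> y_carrier t \<Longrightarrow> p + q \<in> y_carrier t"
  using Poly_Mapping.keys_add[of p q] by (auto simp: y_carrier_def)

lemma y_carrier_mult:
  assumes "p \<in> y_carrier t" "q \<in> y_carrier t" shows "p * q \<in> y_carrier t"
  unfolding y_carrier_def
proof (intro CollectI ballI)
  fix m assume "m \<in> Poly_Mapping.keys (p * q)"
  then obtain a b where "a \<in> Poly_Mapping.keys p" "b \<in> Poly_Mapping.keys q" "m = a + b"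
    using Poly_Mapping.keys_mult[of p q] by blast
  then show "Poly_Mapping.keys m \<subseteq> {..<t}"
    using assms Poly_Mapping.keys_add[of a b] by (fastforce simp: y_carrier_def)
qed

lemma y_carrier_single: "Poly_Mapping.keys m \<subseteq> {..<t} \<Longrightarrow> Poly_Mapping.single m r \<in> y_carrier t"
  by (auto simp: y_carrier_def)

lemma y_carrier_sum: "(\<And>x. x \<in> A \<Longrightarrow> f x \<in> y_carrier t) \<Longrightarrow> sum f A \<in> y_carrier t"
proof (induction A rule: infinite_finite_induct)
  case (insert x A)
  then show ?case by (simp add: y_carrier_add)
qed (auto simp: y_carrier_def)

lemma ring_y_ring: "ring (y_ring t :: ((nat \<Rightarrow>\<^sub>0 nat) \<Rightarrow>\<^sub>0 'r::comm_ring_1) ring)"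
proof -
  interpret R: ring "type_ring :: ((nat \<Rightarrow>\<^sub>0 nat) \<Rightarrow>\<^sub>0 'r) ring" by (rule ring_from_type_algebra)
  have "subring (y_carrier t) (type_ring :: ((nat \<Rightarrow>\<^sub>0 nat) \<Rightarrow>\<^sub>0 'r) ring)"
  proof (rule R.subringI)
    show "\<one>\<^bsub>type_ring\<^esub> \<in> y_carrier t" by (simp add: y_carrier_def)
    fix p :: "(nat \<Rightarrow>\<^sub>0 nat) \<Rightarrow>\<^sub>0 'r" assume p: "p \<in> y_carrier t"
    then show "\<ominus>\<^bsub>type_ring\<^esub> p \<in> y_carrier t"
      by (auto simp: y_carrier_def in_keys_iff)
    fix q :: "(nat \<Rightarrow>\<^sub>0 nat) \<Rightarrow>\<^sub>0 'r" assume "q \<in> y_carrier t"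
    then show "p \<otimes>\<^bsub>type_ring\<^esub> q \<in> y_carrier t" "p \<oplus>\<^bsub>type_ring\<^esub> q \<in> y_carrier t"
      using p by (simp_all add: y_carrier_mult y_carrier_add)
  qed simp
  then show ?thesis unfolding y_ring_eq by (rule R.subring_is_ring)
qed

lemma minus_one_in_y_carrier: "- 1 \<in> y_carrier t"
  by (auto simp: y_carrier_def in_keys_iff)

lemma ideal_y_ringD:
  assumes "ideal J (y_ring t)"
  shows "J \<subseteq> y_carrier t" "0 \<in> J" "p \<in> J \<Longrightarrow> q \<in> J \<Longrightarrow> p + q \<in> J"
    "p \<in> J \<Longrightarrow> q \<in> y_carrier t \<Longrightarrow> q * p \<in> J" "p \<in> J \<Longrightarrow> q \<in> J \<Longrightarrow> p - q \<in> J"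
proof -
  interpret ideal J "y_ring t" by (rule assms)
  show "J \<subseteq> y_carrier t" using additive_subgroup.a_subset[OF is_additive_subgroup] by simp
  show "0 \<in> J" using additive_subgroup.zero_closed[OF is_additive_subgroup] by simp
  show 1: "p \<in> J \<Longrightarrow> q \<in> J \<Longrightarrow> p + q \<in> J" for p q
    using additive_subgroup.a_closed[OF is_additive_subgroup] by simp
  show 2: "p \<in> J \<Longrightarrow> q \<in> y_carrier t \<Longrightarrow> q * p \<in> J" for p q using I_l_closed by simp
  show "p \<in> J \<Longrightarrow> q \<in> J \<Longrightarrow> p - q \<in> J" using 1[of p "- q"] 2[of q "- 1"] by (simp add: minus_one_in_y_carrier)
qed

lemma ideal_y_ringI:
  assumes "J \<subseteq> y_carrier t" "0 \<in> J" "\<And>p q. p \<in> J \<Longrightarrow> q \<in> J \<Longrightarrow> p + q \<in> J"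
    "\<And>p q. p \<in> J \<Longrightarrow> q \<in> y_carrier t \<Longrightarrow> q * p \<in> J"
  shows "ideal J (y_ring t :: ((nat \<Rightarrow>\<^sub>0 nat) \<Rightarrow>\<^sub>0 'r::comm_ring_1) ring)"
proof -
  interpret ring "y_ring t :: ((nat \<Rightarrow>\<^sub>0 nat) \<Rightarrow>\<^sub>0 'r) ring" by (rule ring_y_ring)
  show ?thesis
  proof (rule idealI)
    show "subgroup J (add_monoid (y_ring t))"
    proof (rule add.subgroupI)
      fix p assume p: "p \<in> J"
      then have "- p \<in> J" using assms(4)[OF p minus_one_in_y_carrier] by simp
      moreover have "\<ominus>\<^bsub>y_ring t\<^esub> p = - p"
        using minus_equality[of "- p" p] assms(1) p \<open>- p \<in> J\<close> by (simp add: subset_iff)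
      ultimately show "\<ominus>\<^bsub>y_ring t\<^esub> p \<in> J" by simp
    qed (use assms in auto)
  qed (use assms ring_y_ring in \<open>auto simp: mult.commute\<close>)
qed

definition linear_form :: "nat \<Rightarrow> (nat \<Rightarrow> 'r) \<Rightarrow> (nat \<Rightarrow>\<^sub>0 nat) \<Rightarrow>\<^sub>0 'r::comm_ring_1" where
  "linear_form t v = (\<Sum>j<t. y_term (v j) j)"

lemma linear_form_in_y_carrier: "linear_form t v \<in> y_carrier t"
  unfolding linear_form_def by (rule y_carrier_sum) (auto intro: y_carrier_single)

lemma sym_ideal_ideal: "ideal (sym_ideal t rows) (y_ring t)"
  unfolding sym_ideal_def
  by (rule ring.genideal_ideal[OF ring_y_ring])
    (auto simp del: One_nat_def simp: linear_form_def[symmetric] linear_form_in_y_carrier)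

text \<open>
  The relations whose linear form lies in \<open>J\<close> form a submodule that contains the rows of the relation
  matrix, and the rows generate all relations.
\<close>

lemma linear_form_in_sym_ideal:
  assumes "relation_matrix M g rows" "v \<in> relations M g"
  shows "linear_form (length g) v \<in> sym_ideal (length g) rows"
proof -
  let ?t = "length g"
  let ?J = "sym_ideal ?t rows"
  note J = ideal_y_ringD[OF sym_ideal_ideal[of ?t rows]]
  define N where "N = {v \<in> carrier (free_module {..<?t}). linear_form ?t v \<in> ?J}"
  have "submodule N type_ring (free_module {..<?t})"
    unfolding submodule_iff[OF module_free_module]
  proof (intro conjI ballI allI)
    show "N \<subseteq> carrier (free_module {..<?t})" by (auto simp: N_def)
    show "\<zero>\<^bsub>free_module {..<?t}\<^esub> \<in> N"
      using J(2) by (simp add: N_def free_module_def linear_form_def)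
    fix v w assume vw: "v \<in> N" "w \<in> N"
    have "linear_form ?t (\<lambda>x. v x + w x) = linear_form ?t v + linear_form ?t w"
      by (simp add: linear_form_def sum.distrib single_add)
    then show "v \<oplus>\<^bsub>free_module {..<?t}\<^esub> w \<in> N"
      using vw J(3) by (simp add: N_def free_module_def)
  next
    fix r v assume v: "v \<in> N"
    have "linear_form ?t (\<lambda>x. r * v x) = Poly_Mapping.single 0 r * linear_form ?t v"
      by (simp add: linear_form_def sum_distrib_left mult_single)
    then show "r \<odot>\<^bsub>free_module {..<?t}\<^esub> v \<in> N"
      using v J(4)[of "linear_form ?t v" "Poly_Mapping.single 0 r"]
      by (simp add: N_def free_module_def y_carrier_single)
  qed
  moreover have "set rows \<subseteq> N"
  proof
    fix a assume a: "a \<in> set rows"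
    then have "a \<in> carrier (free_module {..<?t})"
      using assms(1) by (auto simp: relation_matrix_def relations_def)
    moreover have "linear_form ?t a \<in> ?J"
      using a by (auto simp: sym_ideal_def genideal_def linear_form_def)
    ultimately show "a \<in> N" by (simp add: N_def)
  qed
  ultimately have "submodule_gen (free_module {..<?t}) (set rows) \<subseteq> N"
    by (auto simp: submodule_gen_def)
  then show ?thesis using assms by (auto simp: relation_matrix_def N_def)
qed

abbreviation y_exp :: "nat \<Rightarrow> nat \<Rightarrow>\<^sub>0 nat" where "y_exp i \<equiv> Poly_Mapping.single i 1"

lemma single_Suc_0_eq_iff [simp]:
  "Poly_Mapping.single i (Suc 0) = Poly_Mapping.single l (Suc 0) \<longleftrightarrow> i = l"
proof
  assume "Poly_Mapping.single i (Suc 0) = Poly_Mapping.single l (Suc 0)"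
  then have "Poly_Mapping.keys (Poly_Mapping.single i (Suc 0)) = Poly_Mapping.keys (Poly_Mapping.single l (Suc 0))"
    by (rule arg_cong)
  then show "i = l" by simp
qed simp

text \<open>
  Two quadratic monomials have the same degree, so \<open>revlex_less\<close> is decided at the first variable in
  which they differ.
\<close>

lemma revlex_less_quadratic:
  assumes "Poly_Mapping.lookup (y_exp c + y_exp d) i < Poly_Mapping.lookup (y_exp a + y_exp b) i"
    and "\<And>p. p < i \<Longrightarrow> Poly_Mapping.lookup (y_exp a + y_exp b) p = Poly_Mapping.lookup (y_exp c + y_exp d) p"
  shows "revlex_less (y_exp a + y_exp b) (y_exp c + y_exp d)"
proof -
  have deg: "(\<Sum>i\<in>Poly_Mapping.keys m. Poly_Mapping.lookup m i) = 2" if "m = y_exp a + y_exp b" for m a b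
  proof -
    have "(\<Sum>i\<in>Poly_Mapping.keys m. Poly_Mapping.lookup m i) = (\<Sum>i\<in>{a, b}. Poly_Mapping.lookup m i)"
      by (rule sum.mono_neutral_left)
        (auto simp: in_keys_iff that lookup_add lookup_single when_def split: if_splits)
    also have "\<dots> = 2" by (cases "a = b") (auto simp: that lookup_add lookup_single)
    finally show ?thesis .
  qed
  show ?thesis unfolding revlex_less_def Let_def deg[OF refl] using assms by blast
qed

lemma sum_two_blocks:
  fixes f g :: "nat \<Rightarrow> 'x::ab_group_add"
  assumes "a < t" "n \<le> a"
    and "\<And>i. n \<le> i \<Longrightarrow> i \<noteq> a \<Longrightarrow> f i = 0" "\<And>i. i < n \<Longrightarrow> f i = - g i"
  shows "(\<Sum>i<t. f i) = f a - (\<Sum>i<n. g i)"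
proof -
  have "(\<Sum>i<t. f i) = (\<Sum>i\<in>insert a {..<n}. f i)"
    by (rule sum.mono_neutral_right) (use assms in auto)
  also have "\<dots> = f a + (\<Sum>i<n. f i)" using assms(2) by simp
  also have "(\<Sum>i<n. f i) = - (\<Sum>i<n. g i)"
    unfolding sum_negf[symmetric] using assms(4) by (intro sum.cong) auto
  finally show ?thesis by simp
qed

text \<open>
  Let \<open>L = r y\<^sub>j - \<Sum>\<^sub>i\<^sub><\<^sub>j c\<^sub>i y\<^sub>i\<close> be in \<open>J\<close>. Since \<open>r\<close> lies in \<open>I\<^sub>j \<subseteq> I\<^sub>k\<close>, there is also
  \<open>M = r y\<^sub>k - \<Sum>\<^sub>i\<^sub>\<le>\<^sub>l d\<^sub>i y\<^sub>i\<close> in \<open>J\<close>, at first with \<open>l = k - 1\<close>. In \<open>y\<^sub>k L - y\<^sub>j M\<close> the terms \<open>r y\<^sub>j y\<^sub>k\<close> cancel.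
  As long as \<open>l \<ge> j\<close>, the largest monomial left is \<open>y\<^sub>j y\<^sub>l\<close>, with coefficient \<open>d\<^sub>l\<close>, so \<open>d\<^sub>l y\<^sub>j y\<^sub>l\<close> is in the
  initial ideal \<open>(I\<^sub>1 y\<^sub>1, \<dots>, I\<^sub>t y\<^sub>t)\<close>. Thus \<open>d\<^sub>l\<close> lies in \<open>I\<^sub>j + I\<^sub>l = I\<^sub>l\<close>, which means that
  \<open>d\<^sub>l u\<^sub>l \<in> (u\<^sub>1, \<dots>, u\<^sub>l\<^sub>-\<^sub>1)\<close>, and \<open>l\<close> can be lowered by one. When \<open>l\<close> has dropped below \<open>j\<close>,
  \<open>M\<close> says that \<open>r u\<^sub>k \<in> (u\<^sub>1, \<dots>, u\<^sub>j\<^sub>-\<^sub>1)\<close>.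
\<close>

lemma strong_s_sequence_colon_stable:
  assumes I: "is_ideal I" and strong: "strong_s_sequence revlex_less (ring_module\<lparr>carrier := I\<rparr>) us"
  shows "colon_stable us"
  unfolding colon_stable_def
proof (intro allI impI)
  fix k j r assume jk: "k < length us" "j < k" and r: "r * us ! j \<in> prefix_ideal us j"
  let ?M = "ring_module\<lparr>carrier := I\<rparr>"
  define t where "t = length us"
  have us: "set us \<subseteq> I" using strong by (simp add: strong_s_sequence_def s_sequence_def)
  have ann: "annihilator_ideal ?M us i = {r. r * us ! i \<in> prefix_ideal us i}" for i
  proof -
    have "set (take i us) \<subseteq> I" using us set_take_subset by fast
    then show ?thesis
      unfolding annihilator_ideal_def colon_def submodule_gen_ideal[OF I \<open>set (take i us) \<subseteq> I\<close>]
      by (simp add: ring_module_def)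
  qed
  have ann_ideal: "is_ideal (annihilator_ideal ?M us i)" for i
    unfolding ann is_ideal_def using is_idealD[OF ideal_gen_ideal]
    by (auto simp: distrib_right mult.assoc)
  have mono: "annihilator_ideal ?M us i \<subseteq> annihilator_ideal ?M us l" if "i \<le> l" "l < t" for i l
    using strong that by (simp add: strong_s_sequence_def t_def)
  obtain rows where rows: "relation_matrix ?M us rows" and
    init: "Idl\<^bsub>y_ring t\<^esub> {y_term r i | r i. i < t \<and> r \<in> annihilator_ideal ?M us i} =
        initial_ideal revlex_less t (sym_ideal t rows)"
    using strong by (auto simp: strong_s_sequence_def s_sequence_def t_def)
  let ?J = "sym_ideal t rows"
  note J = ideal_y_ringD[OF sym_ideal_ideal[of t rows]]
  have init_coeff: "Poly_Mapping.lookup p m \<in> annihilator_ideal ?M us l"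
    if "p \<in> initial_ideal revlex_less t ?J" "Poly_Mapping.keys m \<subseteq> {..l}" "l < t" for p m l
  proof -
    (* Because the I_i increase, the coefficients in I_l at the monomials in the first l variables
       define an ideal. *)
    define T where "T = {p \<in> y_carrier t. \<forall>m. Poly_Mapping.keys m \<subseteq> {..l} \<longrightarrow>
      Poly_Mapping.lookup p m \<in> annihilator_ideal ?M us l}"
    have "ideal T (y_ring t)"
    proof (rule ideal_y_ringI)
      show "T \<subseteq> y_carrier t" by (auto simp: T_def)
      show "0 \<in> T" using is_idealD(1)[OF ann_ideal] by (simp add: T_def y_carrier_def)
      fix p q assume p: "p \<in> T"
      show "p + q \<in> T" if "q \<in> T"
        using p that is_idealD(2)[OF ann_ideal] by (simp add: T_def lookup_add y_carrier_add)
      assume q: "q \<in> y_carrier t"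
      have "Poly_Mapping.lookup (q * p) m \<in> annihilator_ideal ?M us l"
        if m: "Poly_Mapping.keys m \<subseteq> {..l}" for m
      proof -
        have "(Poly_Mapping.lookup p b when m = a + b) \<in> annihilator_ideal ?M us l" for a b
        proof (cases "m = a + b")
          case True
          then have "Poly_Mapping.keys b \<subseteq> Poly_Mapping.keys m" by (auto simp: in_keys_iff lookup_add)
          then have "Poly_Mapping.keys b \<subseteq> {..l}" using m by blast
          then show ?thesis using p True by (simp add: T_def)
        qed (simp add: is_idealD(1)[OF ann_ideal])
        then show ?thesis
          unfolding lookup_mult Sum_any.expand_set
          by (intro is_ideal_sum[OF ann_ideal] is_idealD(3)[OF ann_ideal])
      qed
      then show "q * p \<in> T" using p q by (simp add: T_def y_carrier_mult)
    qed
    moreover have "{y_term r i | r i. i < t \<and> r \<in> annihilator_ideal ?M us i} \<subseteq> T"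
    proof clarify
      fix r i assume i: "i < t" "r \<in> annihilator_ideal ?M us i"
      have "(r when y_exp i = m) \<in> annihilator_ideal ?M us l" if "Poly_Mapping.keys m \<subseteq> {..l}" for m
        using that i mono[of i l] \<open>l < t\<close> is_idealD(1)[OF ann_ideal] by (auto simp: when_def)
      then show "y_term r i \<in> T" using i by (simp add: T_def y_carrier_single lookup_single)
    qed
    ultimately have "Idl\<^bsub>y_ring t\<^esub> {y_term r i | r i. i < t \<and> r \<in> annihilator_ideal ?M us i} \<subseteq> T"
      by (auto simp: genideal_def)
    then show ?thesis using that init by (auto simp: T_def)
  qed
  have form: "Poly_Mapping.single (y_exp a) s - (\<Sum>i<n. Poly_Mapping.single (y_exp i) (c i)) \<in> ?J"
    if a: "a < t" "n \<le> a" and rel: "s * us ! a = (\<Sum>i<n. c i * us ! i)" for a n s c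
  proof -
    define v where "v i = (if i = a then s else if i < n then - c i else 0)" for i
    have usI: "us ! i \<in> I" if "i < t" for i using us that by (auto simp: t_def)
    have "(\<Sum>i<t. v i * us ! i) = 0"
      using sum_two_blocks[OF a, of "\<lambda>i. v i * us ! i" "\<lambda>i. c i * us ! i"] rel a by (auto simp: v_def)
    moreover have "(\<Oplus>\<^bsub>?M\<^esub>i\<in>{..<t}. v i \<odot>\<^bsub>?M\<^esub> (us ! i)) = (\<Sum>i<t. v i * us ! i)"
      using finsum_ring_module[OF I, of "{..<t}" "\<lambda>i. v i * us ! i"] is_idealD(3)[OF I usI]
      by (simp add: ring_module_def)
    ultimately have "v \<in> relations ?M us"
      using a by (auto simp: relations_def free_module_def v_def t_def[symmetric] ring_module_def)
    then have "linear_form t v \<in> ?J"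
      unfolding t_def by (rule linear_form_in_sym_ideal[OF rows])
    also have "linear_form t v = Poly_Mapping.single (y_exp a) s - (\<Sum>i<n. Poly_Mapping.single (y_exp i) (c i))"
      unfolding linear_form_def
      by (subst sum_two_blocks[OF a, where g = "\<lambda>i. Poly_Mapping.single (y_exp i) (c i)"])
        (use a in \<open>auto simp: v_def single_uminus\<close>)
    finally show ?thesis .
  qed
  have jt: "j < t" "k < t" using jk by (auto simp: t_def)
  obtain c where c: "r * us ! j = (\<Sum>i<j. c i * us ! i)" using r jk by (auto simp: prefix_ideal_iff)
  show "r * us ! k \<in> prefix_ideal us j"
  proof (rule inc_induct[of j k])
    show "j \<le> k" using jk by simp
    show "r * us ! k \<in> prefix_ideal us k" using r mono[of j k] jt jk by (auto simp: ann)
  next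
    fix l assume l: "j \<le> l" "l < k" and "r * us ! k \<in> prefix_ideal us (Suc l)"
    then obtain d where d: "r * us ! k = (\<Sum>i<Suc l. d i * us ! i)"
      using jk by (auto simp: prefix_ideal_iff)
    have lt: "l < t" using l jt by simp
    (* The quadric y_k L - y_j M after cancellation. *)
    define Q where "Q = (\<Sum>i<Suc l. Poly_Mapping.single (y_exp j + y_exp i) (d i))
      - (\<Sum>i<j. Poly_Mapping.single (y_exp k + y_exp i) (c i))"
    define P where "P a s n f = Poly_Mapping.single (y_exp a) s - (\<Sum>i<n. Poly_Mapping.single (y_exp i) (f i))"
      for a s and n :: nat and f :: "nat \<Rightarrow> 'a"
    have "y_term 1 k * P j r j c - y_term 1 j * P k r (Suc l) d \<in> ?J"
      unfolding P_def using jt l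
      by (intro J(5) J(4) form c d y_carrier_single) auto
    also have "y_term 1 k * P j r j c - y_term 1 j * P k r (Suc l) d = Q"
      unfolding P_def Q_def
      by (simp add: right_diff_distrib distrib_left sum_distrib_left mult_single add.commute)
    finally have QJ: "Q \<in> ?J" .
    have "d l \<in> annihilator_ideal ?M us l"
    proof (cases "d l = 0")
      case True then show ?thesis using is_idealD(1)[OF ann_ideal] by simp
    next
      case False
      let ?m = "y_exp j + y_exp l"
      have lookQ: "Poly_Mapping.lookup Q m = (\<Sum>i<Suc l. d i when y_exp j + y_exp i = m)
        - (\<Sum>i<j. c i when y_exp k + y_exp i = m)" for m
        by (simp add: Q_def lookup_minus lookup_add lookup_sum lookup_single)
      have nek: "y_exp k + y_exp i \<noteq> ?m" if "i < j" for i
      proof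
        assume "y_exp k + y_exp i = ?m"
        then have "Poly_Mapping.lookup (y_exp k + y_exp i) i = Poly_Mapping.lookup ?m i" by simp
        then show False using that l by (simp add: lookup_add lookup_single)
      qed
      have "Poly_Mapping.lookup Q ?m = (\<Sum>i<Suc l. d i when i = l)"
        unfolding lookQ using nek by (simp add: when_def)
      also have "\<dots> = d l" by (simp add: when_def)
      finally have Qm: "Poly_Mapping.lookup Q ?m = d l" .
      have "leading_exponent revlex_less Q ?m"
        unfolding leading_exponent_def
      proof (intro conjI ballI impI)
        show "?m \<in> Poly_Mapping.keys Q" using Qm False by (simp add: in_keys_iff)
        fix m assume m: "m \<in> Poly_Mapping.keys Q" "m \<noteq> ?m"
        have "(\<exists>i<Suc l. m = y_exp j + y_exp i) \<or> (\<exists>i<j. m = y_exp k + y_exp i)"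
        proof (rule ccontr)
          assume neg: "\<not> ((\<exists>i<Suc l. m = y_exp j + y_exp i) \<or> (\<exists>i<j. m = y_exp k + y_exp i))"
          then have "(d i when y_exp j + y_exp i = m) = 0" if "i < Suc l" for i
            using that by (auto simp: when_def)
          moreover have "(c i when y_exp k + y_exp i = m) = 0" if "i < j" for i
            using neg that by (auto simp: when_def)
          ultimately have "Poly_Mapping.lookup Q m = 0" unfolding lookQ
            by (simp del: sum.lessThan_Suc One_nat_def)
          then show False using m(1) by (simp add: in_keys_iff)
        qed
        then show "revlex_less m ?m"
        proof
          assume "\<exists>i<Suc l. m = y_exp j + y_exp i"
          then obtain i where i: "i < l" "m = y_exp j + y_exp i" using m(2) by (metis less_SucE)
          show ?thesis unfolding i(2)
            by (rule revlex_less_quadratic[of _ _ i])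
              (use i(1) in \<open>auto simp: lookup_add lookup_single when_def\<close>)
        next
          assume "\<exists>i<j. m = y_exp k + y_exp i"
          then obtain i where i: "i < j" "m = y_exp k + y_exp i" by blast
          show ?thesis unfolding i(2)
            by (rule revlex_less_quadratic[of _ _ i])
              (use i(1) l in \<open>auto simp: lookup_add lookup_single when_def\<close>)
        qed
      qed
      then have "Poly_Mapping.single ?m (Poly_Mapping.lookup Q ?m) \<in> initial_ideal revlex_less t ?J"
        using QJ unfolding initial_ideal_def genideal_def by blast
      moreover have "Poly_Mapping.keys ?m \<subseteq> {..l}"
        using Poly_Mapping.keys_add[of "y_exp j" "y_exp l"] l by auto
      ultimately show ?thesis using init_coeff[of _ ?m l] lt Qm by force
    qed
    then have "d l * us ! l \<in> prefix_ideal us l" by (simp add: ann)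
    moreover have "(\<Sum>i<l. d i * us ! i) \<in> prefix_ideal us l" using lt by (auto simp: prefix_ideal_iff t_def)
    ultimately show "r * us ! k \<in> prefix_ideal us l"
      unfolding d using is_idealD(2)[OF ideal_gen_ideal] by simp
  qed
qed

section \<open>Monomial prime filtrations as chains of sets of exponents\<close>

definition upward :: "('n \<Rightarrow> nat) set \<Rightarrow> ('n \<Rightarrow> nat) set" where
  "upward A = {m. \<exists>a\<in>A. a \<le> m}"

definition up_closed :: "('n \<Rightarrow> nat) set \<Rightarrow> bool" where
  "up_closed U \<longleftrightarrow> (\<forall>a\<in>U. \<forall>b. a \<le> b \<longrightarrow> b \<in> U)"

definition var_upset :: "'n set \<Rightarrow> ('n \<Rightarrow> nat) set" where
  "var_upset F = {m. \<exists>i\<in>F. m i > 0}"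

definition unit_exp :: "'n \<Rightarrow> 'n \<Rightarrow> nat" where
  "unit_exp i = (\<lambda>j. if j = i then 1 else 0)"

definition total :: "('n::finite \<Rightarrow> nat) \<Rightarrow> nat" where
  "total m = (\<Sum>i\<in>UNIV. m i)"

definition shift_upset :: "('n \<Rightarrow> nat) set \<Rightarrow> ('n \<Rightarrow> nat) \<Rightarrow> ('n \<Rightarrow> nat) set" where
  "shift_upset U v = {m. m + v \<in> U}"

text \<open>
  For the monomial ideal \<open>I\<close> with exponent set \<open>U\<close>, this lists the primes of a prime filtration of
  \<open>S/I\<close> by monomial submodules, from the bottom up. In each step the submodule generated by the
  class of \<open>x\<^sup>v\<close> is \<open>S/(I : x\<^sup>v)\<close> up to a shift, and \<open>I : x\<^sup>v\<close> is the prime generated by the variables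
  in \<open>F\<close>.
\<close>

inductive prime_filt :: "('n \<Rightarrow> nat) set \<Rightarrow> 'n set list \<Rightarrow> bool" where
  whole: "prime_filt UNIV []"
| step: "shift_upset U v = var_upset F \<Longrightarrow> prime_filt (U \<union> upward {v}) Fs \<Longrightarrow> prime_filt U (F # Fs)"

lemma upward_Un: "upward (A \<union> B) = upward A \<union> upward B"
  by (auto simp: upward_def)

lemma upward_mono: "a \<in> upward A \<Longrightarrow> a \<le> b \<Longrightarrow> b \<in> upward A"
  unfolding upward_def by (blast intro: order_trans)

lemma up_closed_upward: "up_closed (upward A)"
  using upward_mono by (auto simp: up_closed_def)

lemma upward_eqI:
  assumes "\<And>a. a \<in> A \<Longrightarrow> \<exists>b\<in>B. b \<le> a" "\<And>b. b \<in> B \<Longrightarrow> \<exists>a\<in>A. a \<le> b"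
  shows "upward A = upward B"
  unfolding upward_def using assms by (blast intro: order_trans)

lemma upward_zero: "0 \<in> A \<Longrightarrow> upward A = UNIV"
proof -
  assume "0 \<in> A"
  moreover have "0 \<le> m" for m :: "'a \<Rightarrow> nat" by (simp add: le_fun_def)
  ultimately show ?thesis unfolding upward_def by blast
qed

lemma up_closed_Un: "up_closed U \<Longrightarrow> up_closed V \<Longrightarrow> up_closed (U \<union> V)"
  by (auto simp: up_closed_def)

lemma shift_upward: "shift_upset (upward A) v = upward ((\<lambda>m. m - v) ` A)"
  by (auto simp: shift_upset_def upward_def le_fun_def le_diff_conv)

text \<open>
  This is the extension \<open>0 \<rightarrow> S/(I : v) \<rightarrow> S/I \<rightarrow> S/(I, v) \<rightarrow> 0\<close> at the level of filtrations: a step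
  of \<open>S/(I : v)\<close> with generator \<open>w\<close> becomes a step of \<open>S/I\<close> with generator \<open>w v\<close>.
\<close>

lemma prime_filt_append:
  assumes "prime_filt J Fs" "J = shift_upset U v" "up_closed U"
    "prime_filt (U \<union> upward {v}) Gs"
  shows "prime_filt U (Fs @ Gs)"
  using assms
proof (induction arbitrary: U rule: prime_filt.induct)
  case whole
  have "0 \<in> shift_upset U v" using whole(1) by blast
  then have "v \<in> U" by (simp add: shift_upset_def)
  then have "U \<union> upward {v} = U" using whole(2) by (auto simp: upward_def up_closed_def)
  then show ?case using whole(3) by simp
next
  case (step J w F Fs)
  have le: "m + v \<in> upward {w + v} \<longleftrightarrow> m \<in> upward {w}" for m
    by (auto simp: upward_def le_fun_def)
  have sub: "upward {w + v} \<subseteq> upward {v}"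
    by (auto simp: upward_def le_fun_def intro: add_leD2)
  have "prime_filt (U \<union> upward {w + v}) (Fs @ Gs)"
  proof (rule step.IH)
    show "J \<union> upward {w} = shift_upset (U \<union> upward {w + v}) v"
      using le by (auto simp: shift_upset_def step.prems(1))
    show "up_closed (U \<union> upward {w + v})"
      by (rule up_closed_Un[OF step.prems(2) up_closed_upward])
    have "U \<union> upward {w + v} \<union> upward {v} = U \<union> upward {v}" using sub by blast
    then show "prime_filt (U \<union> upward {w + v} \<union> upward {v}) Gs" using step.prems(3) by simp
  qed
  moreover have "shift_upset U (w + v) = var_upset F"
    using step.hyps(1) step.prems(1) by (simp add: shift_upset_def add.assoc)
  ultimately show ?case by (simp add: prime_filt.step)
qed

lemma upward_unit: "upward (unit_exp ` F) = var_upset F"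
proof -
  have "unit_exp i \<le> m \<longleftrightarrow> m i > 0" for i :: 'a and m
    by (auto simp: unit_exp_def le_fun_def Suc_le_eq)
  then show ?thesis by (auto simp: upward_def var_upset_def)
qed

lemma inj_unit_exp: "inj unit_exp"
proof (rule injI)
  fix i j :: 'a assume "unit_exp i = unit_exp j"
  then have "unit_exp i i = unit_exp j i" by simp
  then show "i = j" by (simp add: unit_exp_def split: if_splits)
qed

lemma total_eq_0 [simp]: "total a = 0 \<longleftrightarrow> a = 0"
  by (auto simp: total_def)

lemma total_diff: "v \<le> a \<Longrightarrow> total (a - v) + total v = total a"
  by (simp add: total_def le_fun_def sum.distrib[symmetric])

section \<open>Complete intersections\<close>

text \<open>
  Monomials different from \<open>1\<close> form a regular sequence, in any order, exactly when they are pairwise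
  coprime.
\<close>

definition regular_exps :: "('n \<Rightarrow> nat) set \<Rightarrow> bool" where
  "regular_exps A \<longleftrightarrow> finite A \<and> 0 \<notin> A \<and> (\<forall>a\<in>A. \<forall>b\<in>A. a \<noteq> b \<longrightarrow> inf a b = 0)"

lemma inf_eq_0_iff: "inf a b = (0 :: 'n \<Rightarrow> nat) \<longleftrightarrow> (\<forall>i. a i = 0 \<or> b i = 0)"
proof -
  have "min k l = 0 \<longleftrightarrow> k = 0 \<or> l = 0" for k l :: nat by (auto simp: min_def)
  then show ?thesis by (simp add: fun_eq_iff inf_nat_def)
qed

lemma inf_eq_0_mono: "inf a b = 0 \<Longrightarrow> a' \<le> a \<Longrightarrow> b' \<le> b \<Longrightarrow> inf a' b' = (0 :: 'n \<Rightarrow> nat)"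
  unfolding inf_eq_0_iff le_fun_def by (metis le_zero_eq)

lemma regular_exps_replace:
  assumes "regular_exps A" "a \<in> A" "b \<le> a" "b \<noteq> 0"
  shows "regular_exps (insert b (A - {a}))" "card (insert b (A - {a})) = card A" "b \<notin> A - {a}"
proof -
  have d: "inf b c = 0" "inf c b = 0" if "c \<in> A - {a}" for c
  proof -
    have "inf a c = 0" using assms that by (auto simp: regular_exps_def)
    then show "inf b c = 0" using inf_eq_0_mono[of a c b c] assms(3) by simp
    then show "inf c b = 0" by (simp add: inf_commute)
  qed
  show nin: "b \<notin> A - {a}" using d(1)[of b] assms(4) by auto
  show "regular_exps (insert b (A - {a}))"
    using assms d by (auto simp: regular_exps_def)
  show "card (insert b (A - {a})) = card A"
  proof -
    have fin: "finite A" using assms(1) by (simp add: regular_exps_def)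
    have "card (insert b (A - {a})) = Suc (card (A - {a}))"
      using nin fin by (intro card_insert_disjoint) auto
    also have "\<dots> = card A" by (rule card.remove[OF fin assms(2), symmetric])
    finally show ?thesis .
  qed
qed

text \<open>
  Dividing by \<open>v\<close> changes only \<open>a\<close>, since \<open>v\<close> is coprime to the other elements.
\<close>

lemma regular_exps_shift:
  assumes "regular_exps A" "a \<in> A" "v \<le> a" "v \<noteq> a"
  shows "(\<lambda>m. m - v) ` A = insert (a - v) (A - {a})" "a - v \<noteq> 0"
proof -
  have "c - v = c" if "c \<in> A" "c \<noteq> a" for c
  proof -
    have "inf a c = 0" using assms that by (auto simp: regular_exps_def)
    then have "inf v c = 0" using inf_eq_0_mono[of a c v c] assms(3) by simp
    then have "v i = 0 \<or> c i = 0" for i by (simp only: inf_eq_0_iff)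
    then have "c i - v i = c i" for i by (metis diff_zero zero_diff)
    then show ?thesis by (simp add: fun_eq_iff)
  qed
  then have "(\<lambda>m. m - v) ` (A - {a}) = A - {a}" by (auto simp: image_iff)
  then show "(\<lambda>m. m - v) ` A = insert (a - v) (A - {a})"
    using assms(2) by (metis image_insert insert_Diff)
  show "a - v \<noteq> 0"
  proof
    assume "a - v = 0"
    then have "a \<le> v" by (metis diff_is_0_eq fun_diff_def le_funI zero_fun_apply)
    then show False using assms by simp
  qed
qed

text \<open>
  If all elements are variables, the ideal is already prime. Otherwise let a variable \<open>x\<close> properly
  divide \<open>a\<close>. Then \<open>I : x\<close> and \<open>(I, x)\<close> are complete intersections of the same length, with \<open>a\<close>
  replaced by \<open>a/x\<close> and by \<open>x\<close>; both have smaller total degree.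
\<close>

lemma prime_filt_regular:
  assumes "regular_exps (A :: ('n::finite \<Rightarrow> nat) set)"
  shows "\<exists>Fs. prime_filt (upward A) Fs \<and> (\<forall>F\<in>set Fs. card F = card A)"
  using assms
proof (induction "sum total A" arbitrary: A rule: less_induct)
  case less
  have fin: "finite A" using less.prems by (simp add: regular_exps_def)
  show ?case
  proof (cases "A \<subseteq> range unit_exp")
    case True
    then obtain F :: "'n set" where F: "A = unit_exp ` F" by (auto simp: subset_image_iff)
    have "card F = card A" unfolding F by (rule card_image[symmetric]) (rule inj_on_subset[OF inj_unit_exp subset_UNIV])
    moreover have "prime_filt (upward A) [F]"
    proof (rule prime_filt.step)
      show "shift_upset (upward A) 0 = var_upset F" by (simp add: F upward_unit shift_upset_def)
      have "upward A \<union> upward {0} = UNIV" by (simp add: upward_zero)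
      then show "prime_filt (upward A \<union> upward {0}) []" by (simp add: prime_filt.whole)
    qed
    ultimately show ?thesis by (intro exI[of _ "[F]"]) simp
  next
    case False
    then obtain a where a: "a \<in> A" "a \<notin> range unit_exp" by blast
    then have "a \<noteq> 0" using less.prems by (auto simp: regular_exps_def)
    then obtain i where i: "a i > 0" by (auto simp: fun_eq_iff)
    define v :: "'n \<Rightarrow> nat" where "v = unit_exp i"
    have v: "v \<le> a" "v \<noteq> a" using i a(2)
      by (auto simp: v_def le_fun_def unit_exp_def Suc_le_eq)
    have "v i \<noteq> 0" by (simp add: v_def unit_exp_def)
    then have v0: "v \<noteq> 0" by (metis zero_fun_apply)
    note sh = regular_exps_shift[OF less.prems a(1) v(1,2)]
    have dt: "total (a - v) + total v = total a" by (rule total_diff[OF v(1)])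
    have tv: "total v > 0" "total (a - v) > 0" using v0 sh(2) by (simp_all only: total_eq_0 neq0_conv[symmetric] not_False_eq_True)
    have sm: "sum total (insert b (A - {a})) < sum total A"
      if "b \<notin> A - {a}" "total b < total a" for b
      using that fin a(1) by (simp add: sum.remove[of A a])
    note r1 = regular_exps_replace[OF less.prems a(1) v(1) v0]
    have "a - v \<le> a" by (simp add: le_fun_def)
    note r2 = regular_exps_replace[OF less.prems a(1) this sh(2)]
    obtain Gs where Gs: "prime_filt (upward (insert v (A - {a}))) Gs" "\<forall>F\<in>set Gs. card F = card A"
      using less.hyps[OF sm r1(1)] r1 dt tv by auto
    obtain Fs where Fs: "prime_filt (upward (insert (a - v) (A - {a}))) Fs" "\<forall>F\<in>set Fs. card F = card A"
      using less.hyps[OF sm r2(1)] r2 dt tv by auto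
    have "prime_filt (upward A) (Fs @ Gs)"
    proof (rule prime_filt_append[OF Fs(1)])
      show "upward (insert (a - v) (A - {a})) = shift_upset (upward A) v"
        by (simp add: shift_upward sh)
      show "up_closed (upward A)" by (rule up_closed_upward)
      have "upward A \<union> upward {v} = upward (A \<union> {v})" by (simp only: upward_Un)
      also have "\<dots> = upward (insert v (A - {a}))"
        by (rule upward_eqI) (use v(1) in auto)
      finally show "prime_filt (upward A \<union> upward {v}) Gs" using Gs(1) by simp
    qed
    then show ?thesis using Fs(2) Gs(2) by (intro exI[of _ "Fs @ Gs"]) auto
  qed
qed

section \<open>Filtrations from divisibility by the earlier greatest common divisors\<close>

text \<open>
  Carrying the earlier elements as a set \<open>A\<close> lets the induction below keep its coprime front part
  unordered.
\<close>

fun gcd_chain :: "('n \<Rightarrow> nat) set \<Rightarrow> ('n \<Rightarrow> nat) list \<Rightarrow> bool" where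
  "gcd_chain A [] \<longleftrightarrow> True"
| "gcd_chain A (w # ws) \<longleftrightarrow> (\<forall>a\<in>A. \<forall>w'\<in>set ws. inf a w \<le> w') \<and> gcd_chain (insert w A) ws"

text \<open>
  In each variable the condition only compares exponents, and \<open>m \<mapsto> m - v\<close> is monotone.
\<close>

lemma gcd_chain_diff:
  "gcd_chain A ws \<Longrightarrow> gcd_chain ((\<lambda>m. m - v) ` A) (map (\<lambda>m. m - v) ws)"
proof (induction ws arbitrary: A)
  case (Cons w ws)
  have "inf (a - v) (w - v) \<le> w' - v" if "inf a w \<le> w'" for a w' :: "'a \<Rightarrow> nat"
  proof (rule le_funI)
    fix i have "min (a i) (w i) \<le> w' i" using that by (simp add: le_fun_def inf_nat_def)
    then show "inf (a - v) (w - v) i \<le> (w' - v) i" by (auto simp: inf_nat_def min_def split: if_splits)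
  qed
  note le = this
  then show ?case using Cons.prems Cons.IH[of "insert w A"] le by (auto simp: fun_diff_def)
qed simp

text \<open>
  While the next monomial \<open>w\<close> is coprime to \<open>A\<close>, it is moved into \<open>A\<close>. Otherwise let \<open>v = gcd(a, w) \<noteq> 1\<close>
  with \<open>a \<in> A\<close>; it divides every monomial of the list. So \<open>(I, v)\<close> is the complete intersection of \<open>v\<close>
  and \<open>A - {a}\<close>, of height \<open>card A\<close>, and \<open>I : v\<close> is again of the given form with \<open>card A\<close> coprime
  elements. Its primes have height at least \<open>card A\<close> and come first in the filtration. Total degree
  plus length of the list decreases: the first move shortens the list, the second lowers the degree.
\<close>

theorem prime_filt_gcd_chain:
  fixes A :: "('n::finite \<Rightarrow> nat) set"
  assumes "regular_exps A" "0 \<notin> set ws" "gcd_chain A ws"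
  shows "\<exists>Fs. prime_filt (upward (A \<union> set ws)) Fs \<and> (\<forall>F\<in>set Fs. card A \<le> card F) \<and>
    sorted_wrt (\<lambda>F G. card G \<le> card F) Fs"
  using assms
proof (induction "sum total A + sum_list (map total ws) + length ws" arbitrary: A ws rule: less_induct)
  case less
  have fin: "finite A" using less.prems by (simp add: regular_exps_def)
  have const: "sorted_wrt (\<lambda>F G. card G \<le> card F) Fs" if "\<forall>F\<in>set Fs. card F = c" for Fs :: "'n set list" and c
    using that by (induction Fs) auto
  show ?case
  proof (cases ws)
    case Nil
    then show ?thesis using prime_filt_regular[OF less.prems(1)] const by force
  next
    case (Cons w ws')
    have w0: "w \<noteq> 0" using less.prems Cons by auto
    show ?thesis
    proof (cases "\<forall>a\<in>A. inf a w = 0")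
      case True
      then have "w \<notin> A" using w0 by auto
      have "regular_exps (insert w A)"
        using True less.prems w0 by (auto simp: regular_exps_def inf_commute)
      moreover have "sum total (insert w A) + sum_list (map total ws') + length ws'
          < sum total A + sum_list (map total ws) + length ws"
        using \<open>w \<notin> A\<close> fin by (simp add: Cons)
      ultimately obtain Fs where "prime_filt (upward (insert w A \<union> set ws')) Fs"
        "\<forall>F\<in>set Fs. card (insert w A) \<le> card F" "sorted_wrt (\<lambda>F G. card G \<le> card F) Fs"
        using less.hyps[of "insert w A" ws'] less.prems Cons by auto
      then show ?thesis using \<open>w \<notin> A\<close> fin by (intro exI[of _ Fs]) (auto simp: Cons)
    next
      case False
      then obtain a where a: "a \<in> A" "inf a w \<noteq> 0" by blast
      define v where "v = inf a w"
      define U where "U = upward (A \<union> set ws)"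
      have v: "v \<le> a" "v \<noteq> 0" using a by (auto simp: v_def)
      note r = regular_exps_replace[OF less.prems(1) a(1) v]
      have vw: "v \<le> w'" if "w' \<in> set ws" for w'
        using that less.prems(3) a(1) by (auto simp: Cons v_def)
      have Uv: "U \<union> upward {v} = upward (insert v (A - {a}))"
      proof -
        have "U \<union> upward {v} = upward (A \<union> set ws \<union> {v})" by (simp only: upward_Un U_def)
        also have "\<dots> = upward (insert v (A - {a}))"
          by (rule upward_eqI) (use v(1) vw in auto)
        finally show ?thesis .
      qed
      obtain Gs where Gs: "prime_filt (U \<union> upward {v}) Gs" "\<forall>F\<in>set Gs. card F = card A"
        using prime_filt_regular[OF r(1)] r(2) Uv by auto
      show ?thesis
      proof (cases "v \<in> U")
        (* Here v is in I, so I = (I, v) is itself a complete intersection. *)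
        case True
        then have "U \<union> upward {v} = U" unfolding U_def using upward_mono by (auto simp: upward_def[of "{v}"])
        then have "prime_filt (upward (A \<union> set ws)) Gs" using Gs(1) by (simp add: U_def)
        then show ?thesis using Gs const by (metis order_refl)
      next
        case False
        have nle: "\<not> m \<le> v" if "m \<in> A \<union> set ws" for m
          using that False by (auto simp: U_def upward_def)
        have n0: "m - v \<noteq> 0" if "m \<in> A \<union> set ws" for m
        proof
          assume "m - v = 0"
          then have "m \<le> v" by (metis diff_is_0_eq fun_diff_def le_funI zero_fun_apply)
          then show False using nle that by simp
        qed
        have va: "v \<noteq> a" using nle a(1) by auto
        note sh = regular_exps_shift[OF less.prems(1) a(1) v(1) va]
        have av: "a - v \<le> a" by (simp add: le_fun_def)
        note r2 = regular_exps_replace[OF less.prems(1) a(1) av sh(2)]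
        let ?B = "insert (a - v) (A - {a})" and ?ws = "map (\<lambda>m. m - v) ws"
        have "total (a - v) + total v = total a" by (rule total_diff[OF v(1)])
        moreover have "total v > 0" using v(2) by (simp only: total_eq_0 neq0_conv[symmetric] not_False_eq_True)
        ultimately have "sum total ?B < sum total A"
          using r2(3) fin a(1) by (simp add: sum.remove[of A a])
        moreover have "sum_list (map total ?ws) \<le> sum_list (map total ws)"
          by (simp add: comp_def) (rule sum_list_mono, simp add: total_def sum_mono)
        ultimately have "sum total ?B + sum_list (map total ?ws) + length ?ws
            < sum total A + sum_list (map total ws) + length ws" by simp
        moreover have "gcd_chain ?B ?ws" using gcd_chain_diff[OF less.prems(3), of v] sh(1) by simp
        moreover have "0 \<notin> set ?ws" using n0 by (auto simp: eq_commute[of 0])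
        ultimately obtain Fs where Fs: "prime_filt (upward (?B \<union> set ?ws)) Fs"
          "\<forall>F\<in>set Fs. card ?B \<le> card F" "sorted_wrt (\<lambda>F G. card G \<le> card F) Fs"
          using less.hyps[of ?B ?ws] r2(1) by blast
        have "prime_filt U (Fs @ Gs)"
        proof (rule prime_filt_append[OF Fs(1) _ _ Gs(1)])
          show "upward (?B \<union> set ?ws) = shift_upset U v"
            unfolding U_def shift_upward by (simp only: image_Un sh(1) set_map)
          show "up_closed U" unfolding U_def by (rule up_closed_upward)
        qed
        moreover have "sorted_wrt (\<lambda>F G. card G \<le> card F) (Fs @ Gs)"
          using Fs Gs const[OF Gs(2)] r2(2) by (auto simp: sorted_wrt_append)
        ultimately show ?thesis using Fs(2) Gs(2) r2(2)
          by (intro exI[of _ "Fs @ Gs"]) (auto simp: U_def)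
      qed
    qed
  qed
qed

lemma up_closed_var_upset: "up_closed (var_upset F)"
  by (force simp: up_closed_def var_upset_def le_fun_def intro: less_le_trans)

section \<open>Monomial ideals of the polynomial ring\<close>

definition mono_ideal :: "('n \<Rightarrow> nat) set \<Rightarrow> ('n::finite, 'k::field) mpoly set" where
  "mono_ideal U = {p. \<forall>m\<in>Poly_Mapping.keys p. Poly_Mapping.lookup m \<in> U}"

lemma single_in_mono_ideal [simp]:
  "Poly_Mapping.single m c \<in> mono_ideal U \<longleftrightarrow> c = 0 \<or> Poly_Mapping.lookup m \<in> U"
  by (simp add: mono_ideal_def)

lemma sum_single: "(\<Sum>m\<in>Poly_Mapping.keys p. Poly_Mapping.single m (Poly_Mapping.lookup p m)) = p"
  by (rule poly_mapping_eqI) (auto simp: lookup_sum lookup_single when_def sum.delta in_keys_iff)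

lemma mono_ideal_induct [consumes 1, case_names zero add monomial]:
  assumes "p \<in> mono_ideal U" "P 0" "\<And>p q. P p \<Longrightarrow> P q \<Longrightarrow> P (p + q)"
    "\<And>m c. Poly_Mapping.lookup m \<in> U \<Longrightarrow> P (Poly_Mapping.single m c)"
  shows "P p"
proof -
  have "P (\<Sum>m\<in>A. Poly_Mapping.single m (Poly_Mapping.lookup p m))" if "A \<subseteq> Poly_Mapping.keys p" for A
    using finite_subset[OF that finite_keys] that
    by (induction A) (use assms in \<open>auto simp: mono_ideal_def\<close>)
  from this[OF subset_refl] show ?thesis by (simp add: sum_single)
qed

lemma is_ideal_mono_ideal:
  assumes "up_closed U"
  shows "is_ideal (mono_ideal U)"
  unfolding is_ideal_def
proof (intro conjI ballI allI)
  show "0 \<in> mono_ideal U" by (simp add: mono_ideal_def)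
  fix p :: "('a, 'b) mpoly" assume p: "p \<in> mono_ideal U"
  show "p + q \<in> mono_ideal U" if "q \<in> mono_ideal U" for q
    using p that Poly_Mapping.keys_add[of p q] by (auto simp: mono_ideal_def)
  show "r * p \<in> mono_ideal U" for r
    unfolding mono_ideal_def
  proof (intro CollectI ballI)
    fix m assume "m \<in> Poly_Mapping.keys (r * p)"
    then obtain a b where "b \<in> Poly_Mapping.keys p" "m = a + b"
      using Poly_Mapping.keys_mult[of r p] by blast
    moreover have "Poly_Mapping.lookup b \<le> Poly_Mapping.lookup (a + b)"
      by (simp add: le_fun_def lookup_add)
    ultimately show "Poly_Mapping.lookup m \<in> U"
      using p assms by (auto simp: mono_ideal_def up_closed_def)
  qed
qed

lemma ideal_gen_monomials:
  "ideal_gen ((\<lambda>m. Poly_Mapping.single m 1) ` E) = (mono_ideal (upward (Poly_Mapping.lookup ` E)) :: ('n::finite, 'k::field) mpoly set)"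
    (is "ideal_gen ?B = ?J")
proof
  have "Poly_Mapping.lookup m \<in> upward (Poly_Mapping.lookup ` E)" if "m \<in> E" for m
    using that by (auto simp: upward_def)
  then show "ideal_gen ?B \<subseteq> ?J"
    by (intro ideal_gen_least is_ideal_mono_ideal up_closed_upward) auto
  show "?J \<subseteq> ideal_gen ?B"
  proof
    fix p assume "p \<in> ?J"
    then show "p \<in> ideal_gen ?B"
    proof (induction rule: mono_ideal_induct)
      case (monomial m c)
      then obtain e where e: "e \<in> E" "Poly_Mapping.lookup e \<le> Poly_Mapping.lookup m" by (auto simp: upward_def)
      have "m - e + e = m" using e(2)
        by (intro poly_mapping_eqI) (simp add: lookup_add lookup_minus le_fun_def)
      then have "Poly_Mapping.single m c = Poly_Mapping.single (m - e) c * Poly_Mapping.single e 1"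
        by (simp add: mult_single)
      then show ?case using e(1) ideal_gen_subset[of ?B]
        by (auto intro!: is_idealD(3)[OF ideal_gen_ideal])
    qed (auto intro: is_idealD[OF ideal_gen_ideal])
  qed
qed

text \<open>
  The coefficient of a monomial that arises in only one way as a product of monomials of the factors
  cannot cancel.
\<close>

lemma lookup_mult_unique:
  fixes p q :: "('n::finite, 'k::field) mpoly"
  assumes "\<And>l r. l \<in> Poly_Mapping.keys p \<Longrightarrow> r \<in> Poly_Mapping.keys q \<Longrightarrow> l + r = a + b \<Longrightarrow> l = a \<and> r = b"
  shows "Poly_Mapping.lookup (p * q) (a + b) = Poly_Mapping.lookup p a * Poly_Mapping.lookup q b"
proof -
  let ?p = "p - Poly_Mapping.single a (Poly_Mapping.lookup p a)"
  let ?q = "q - Poly_Mapping.single b (Poly_Mapping.lookup q b)"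
  have kp: "l \<in> Poly_Mapping.keys p \<and> l \<noteq> a" if "l \<in> Poly_Mapping.keys ?p" for l
    using that by (auto simp: in_keys_iff lookup_minus lookup_single when_def split: if_splits)
  have kq: "l \<in> Poly_Mapping.keys q \<and> l \<noteq> b" if "l \<in> Poly_Mapping.keys ?q" for l
    using that by (auto simp: in_keys_iff lookup_minus lookup_single when_def split: if_splits)
  have "a + b \<notin> Poly_Mapping.keys (?p * q)"
  proof
    assume "a + b \<in> Poly_Mapping.keys (?p * q)"
    then obtain l r where lr: "l \<in> Poly_Mapping.keys ?p" "r \<in> Poly_Mapping.keys q" "a + b = l + r"
      using subsetD[OF Poly_Mapping.keys_mult] by blast
    then show False using kp[OF lr(1)] assms[of l r] by simp
  qed
  moreover have "a + b \<notin> Poly_Mapping.keys (Poly_Mapping.single a (Poly_Mapping.lookup p a) * ?q)"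
  proof
    assume "a + b \<in> Poly_Mapping.keys (Poly_Mapping.single a (Poly_Mapping.lookup p a) * ?q)"
    then obtain l r where lr: "l \<in> Poly_Mapping.keys (Poly_Mapping.single a (Poly_Mapping.lookup p a))"
      "r \<in> Poly_Mapping.keys ?q" "a + b = l + r"
      using subsetD[OF Poly_Mapping.keys_mult] by blast
    then have "l = a" by (simp split: if_splits)
    then show False using kq[OF lr(2)] lr(3) by simp
  qed
  moreover have "p * q = ?p * q + Poly_Mapping.single a (Poly_Mapping.lookup p a) * ?q
      + Poly_Mapping.single (a + b) (Poly_Mapping.lookup p a * Poly_Mapping.lookup q b)"
    by (simp add: mult_single[symmetric] algebra_simps)
  ultimately show ?thesis
    by (metis (no_types, lifting) add_0 in_keys_iff lookup_add lookup_single_eq)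
qed

lemma mult_monomial_in_mono_ideal:
  fixes r :: "('n::finite, 'k::field) mpoly"
  assumes "up_closed U"
  shows "r * Poly_Mapping.single e 1 \<in> mono_ideal U \<longleftrightarrow>
    r \<in> mono_ideal (shift_upset U (Poly_Mapping.lookup e))"
proof
  assume L: "r * Poly_Mapping.single e 1 \<in> mono_ideal U"
  show "r \<in> mono_ideal (shift_upset U (Poly_Mapping.lookup e))"
    unfolding mono_ideal_def
  proof (intro CollectI ballI)
    fix m assume m: "m \<in> Poly_Mapping.keys r"
    have "Poly_Mapping.lookup (r * Poly_Mapping.single e 1) (m + e) = Poly_Mapping.lookup r m * 1"
      by (subst lookup_mult_unique) auto
    then have "m + e \<in> Poly_Mapping.keys (r * Poly_Mapping.single e 1)" using m by (simp add: in_keys_iff)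
    then have "Poly_Mapping.lookup (m + e) \<in> U" using L by (simp add: mono_ideal_def)
    moreover have "Poly_Mapping.lookup (m + e) = Poly_Mapping.lookup m + Poly_Mapping.lookup e"
      by (simp add: fun_eq_iff lookup_add)
    ultimately show "Poly_Mapping.lookup m \<in> shift_upset U (Poly_Mapping.lookup e)"
      by (simp add: shift_upset_def)
  qed
next
  assume "r \<in> mono_ideal (shift_upset U (Poly_Mapping.lookup e))"
  then show "r * Poly_Mapping.single e 1 \<in> mono_ideal U"
  proof (induction rule: mono_ideal_induct)
    case (monomial m c)
    moreover have "Poly_Mapping.lookup (m + e) = Poly_Mapping.lookup m + Poly_Mapping.lookup e"
      by (simp add: fun_eq_iff lookup_add)
    ultimately show ?case by (simp add: mult_single shift_upset_def)
  qed (auto simp: distrib_right is_idealD[OF is_ideal_mono_ideal[OF assms]])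
qed

text \<open>
  For \<open>p\<close> and \<open>q\<close> outside the ideal, consider in each only the monomials without a variable from \<open>F\<close>,
  and take the largest ones in a total order that is compatible with multiplication. Their product is
  not cancelled in \<open>p q\<close> and contains no variable from \<open>F\<close>. The total order is pulled back along \<open>\<phi>\<close>,
  which numbers the variables by \<open>e\<close>, from the ordered monoid \<open>nat \<Rightarrow>\<^sub>0 nat\<close>.
\<close>

lemma primeideal_var_upset:
  "primeideal (mono_ideal (var_upset F) :: ('n::finite, 'k::field) mpoly set) type_ring"
proof (rule primeidealI)
  let ?P = "mono_ideal (var_upset F) :: ('n, 'k) mpoly set"
  show "ideal ?P type_ring"
    unfolding ideal_type_iff by (rule is_ideal_mono_ideal[OF up_closed_var_upset])
  show "cring (type_ring :: ('n, 'k) mpoly ring)" by (rule cring_from_type_algebra)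
  have "1 \<notin> ?P" by (simp add: single_one[symmetric] var_upset_def del: single_one)
  then show "carrier type_ring \<noteq> ?P" by auto
  obtain e :: "'n \<Rightarrow> nat" where e: "inj e"
    using finite_imp_inj_to_nat_seg[OF finite_UNIV] by auto
  define \<phi> :: "('n \<Rightarrow>\<^sub>0 nat) \<Rightarrow> (nat \<Rightarrow>\<^sub>0 nat)" where
    "\<phi> m = (\<Sum>i\<in>UNIV. Poly_Mapping.single (e i) (Poly_Mapping.lookup m i))" for m
  have \<phi>_add: "\<phi> (a + b) = \<phi> a + \<phi> b" for a b
    by (simp add: \<phi>_def lookup_add single_add sum.distrib)
  have "Poly_Mapping.lookup (\<phi> m) (e i) = Poly_Mapping.lookup m i" for m i
    by (simp add: \<phi>_def lookup_sum lookup_single inj_eq[OF e] when_def)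
  then have \<phi>_inj: "\<phi> a = \<phi> b \<Longrightarrow> a = b" for a b
    by (metis poly_mapping_eqI)
  have top: "\<exists>a\<in>Poly_Mapping.keys p. Poly_Mapping.lookup a \<notin> var_upset F \<and>
      (\<forall>l\<in>Poly_Mapping.keys p. Poly_Mapping.lookup l \<notin> var_upset F \<longrightarrow> \<phi> l \<le> \<phi> a)"
    if "p \<notin> ?P" for p
  proof -
    define A where "A = {l \<in> Poly_Mapping.keys p. Poly_Mapping.lookup l \<notin> var_upset F}"
    have "finite A" "A \<noteq> {}" using that by (auto simp: A_def mono_ideal_def)
    then have "Max (\<phi> ` A) \<in> \<phi> ` A" "\<forall>l\<in>A. \<phi> l \<le> Max (\<phi> ` A)" by auto
    then obtain a where "a \<in> A" "\<forall>l\<in>A. \<phi> l \<le> \<phi> a" by auto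
    then show ?thesis by (auto simp: A_def)
  qed
  have V: "Poly_Mapping.lookup (l + r) \<in> var_upset F \<longleftrightarrow>
      Poly_Mapping.lookup l \<in> var_upset F \<or> Poly_Mapping.lookup r \<in> var_upset F" for l r
    by (auto simp: var_upset_def lookup_add)
  fix p q :: "('n, 'k) mpoly"
  assume pq: "p \<otimes>\<^bsub>type_ring\<^esub> q \<in> ?P"
  show "p \<in> ?P \<or> q \<in> ?P"
  proof (rule ccontr)
    assume "\<not> (p \<in> ?P \<or> q \<in> ?P)"
    then have "p \<notin> ?P" "q \<notin> ?P" by auto
    obtain a where a: "a \<in> Poly_Mapping.keys p" "Poly_Mapping.lookup a \<notin> var_upset F"
      "\<And>l. l \<in> Poly_Mapping.keys p \<Longrightarrow> Poly_Mapping.lookup l \<notin> var_upset F \<Longrightarrow> \<phi> l \<le> \<phi> a"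
      using top[OF \<open>p \<notin> ?P\<close>] by blast
    obtain b where b: "b \<in> Poly_Mapping.keys q" "Poly_Mapping.lookup b \<notin> var_upset F"
      "\<And>l. l \<in> Poly_Mapping.keys q \<Longrightarrow> Poly_Mapping.lookup l \<notin> var_upset F \<Longrightarrow> \<phi> l \<le> \<phi> b"
      using top[OF \<open>q \<notin> ?P\<close>] by blast
    have ab: "Poly_Mapping.lookup (a + b) \<notin> var_upset F" using V a(2) b(2) by simp
    have "Poly_Mapping.lookup (p * q) (a + b) = Poly_Mapping.lookup p a * Poly_Mapping.lookup q b"
    proof (rule lookup_mult_unique)
      fix l r assume lr: "l \<in> Poly_Mapping.keys p" "r \<in> Poly_Mapping.keys q" "l + r = a + b"
      then have "Poly_Mapping.lookup l \<notin> var_upset F" "Poly_Mapping.lookup r \<notin> var_upset F"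
        using ab V by metis+
      then have le: "\<phi> l \<le> \<phi> a" "\<phi> r \<le> \<phi> b" using a(3) b(3) lr by auto
      have eq: "\<phi> l + \<phi> r = \<phi> a + \<phi> b" using lr(3) \<phi>_add by metis
      have "\<phi> l = \<phi> a"
      proof (rule ccontr)
        assume "\<phi> l \<noteq> \<phi> a"
        then have "\<phi> l < \<phi> a" using le by simp
        then have "\<phi> l + \<phi> r < \<phi> a + \<phi> b" using le(2) by (rule add_less_le_mono)
        then show False using eq by simp
      qed
      then show "l = a \<and> r = b" using eq \<phi>_inj by simp
    qed
    then have "a + b \<in> Poly_Mapping.keys (p * q)" using a(1) b(1) by (simp add: in_keys_iff)
    then show False using pq ab by (auto simp: mono_ideal_def)
  qed
qed

lemma mono_ideal_var_upset_subset:
  assumes "(mono_ideal (var_upset F) :: ('n::finite, 'k::field) mpoly set) \<subseteq> mono_ideal (var_upset G)"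
  shows "F \<subseteq> G"
proof
  fix i assume "i \<in> F"
  then have "(Poly_Mapping.single (Poly_Mapping.single i 1) 1 :: ('n, 'k) mpoly) \<in> mono_ideal (var_upset F)"
    by (auto simp: var_upset_def intro!: bexI[of _ i])
  then have "(Poly_Mapping.single (Poly_Mapping.single i 1) 1 :: ('n, 'k) mpoly) \<in> mono_ideal (var_upset G)"
    using assms by blast
  then show "i \<in> G" by (auto simp: var_upset_def lookup_single when_def split: if_splits)
qed

section \<open>Quotients of quotients\<close>

definition coset :: "'r::comm_ring_1 set \<Rightarrow> 'r \<Rightarrow> 'r set" where
  "coset I x = (\<lambda>y. y + x) ` I"

lemma coset_mem: "y \<in> coset I x \<longleftrightarrow> y - x \<in> I"
  by (force simp: coset_def image_iff algebra_simps)

lemma coset_eq_iff: "is_ideal I \<Longrightarrow> coset I x = coset I y \<longleftrightarrow> x - y \<in> I"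
proof
  assume I: "is_ideal I" and "coset I x = coset I y"
  then have "x \<in> coset I y" using coset_mem[of x I x] is_idealD(1)[OF I] by simp
  then show "x - y \<in> I" by (simp add: coset_mem)
next
  assume I: "is_ideal I" and xy: "x - y \<in> I"
  have "z - x \<in> I \<longleftrightarrow> z - y \<in> I" for z
    using is_idealD(2)[OF I _ xy, of "z - x"] is_idealD(5)[OF I _ xy, of "z - y"] by auto
  then show "coset I x = coset I y" by (auto simp: coset_mem)
qed

lemma ring_module_coset: "I +>\<^bsub>ring_module\<^esub> x = coset I x"
  by (simp add: a_r_coset_eq coset_def ring_module_def)

lemma quot_module_carrier: "carrier (quot_module M N) = (\<lambda>x. N +>\<^bsub>M\<^esub> x) ` carrier M"
  by (auto simp: quot_module_def A_RCOSETS_def RCOSETS_def a_r_coset_def)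

abbreviation quot_ring :: "'r::comm_ring_1 set \<Rightarrow> ('r, 'r set) module" where
  "quot_ring I \<equiv> quot_module ring_module I"

lemma quot_ring_carrier: "carrier (quot_ring I) = range (coset I)"
  by (auto simp: quot_module_def A_RCOSETS_def RCOSETS_def ring_module_coset[symmetric] a_r_coset_def ring_module_def)

lemma quot_ring_zero: "\<zero>\<^bsub>quot_ring I\<^esub> = coset I 0"
  by (simp_all add: quot_module_def coset_def)

lemma coset_Union:
  assumes "is_ideal I"
  shows "(\<Union>y\<in>coset I x. coset I (r * y)) = coset I (r * x)"
proof -
  have "coset I (r * y) = coset I (r * x)" if "y \<in> coset I x" for y
    using that is_idealD(3)[OF assms, of "y - x" r]
    by (simp add: coset_eq_iff[OF assms] coset_mem right_diff_distrib)
  moreover have "x \<in> coset I x" using is_idealD(1)[OF assms] by (simp add: coset_mem)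
  ultimately show ?thesis by blast
qed

lemma coset_add:
  assumes "is_ideal I"
  shows "(\<Union>y\<in>coset I x. \<Union>z\<in>coset I x'. {y + z}) = coset I (x + x')"
proof -
  have "w \<in> (\<Union>y\<in>coset I x. \<Union>z\<in>coset I x'. {y + z}) \<longleftrightarrow> w \<in> coset I (x + x')" for w
  proof
    assume "w \<in> coset I (x + x')"
    then have "w - x' \<in> coset I x" by (simp add: coset_mem algebra_simps)
    moreover have "x' \<in> coset I x'" using is_idealD(1)[OF assms] by (simp add: coset_mem)
    ultimately show "w \<in> (\<Union>y\<in>coset I x. \<Union>z\<in>coset I x'. {y + z})" by force
  next
    assume "w \<in> (\<Union>y\<in>coset I x. \<Union>z\<in>coset I x'. {y + z})"
    then obtain y z where "y - x \<in> I" "z - x' \<in> I" "w = y + z" by (auto simp: coset_mem)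
    then show "w \<in> coset I (x + x')" using is_idealD(2)[OF assms, of "y - x" "z - x'"]
      by (simp add: coset_mem algebra_simps)
  qed
  then show ?thesis by blast
qed

lemma quot_ring_ops:
  assumes "is_ideal I"
  shows "coset I x \<oplus>\<^bsub>quot_ring I\<^esub> coset I y = coset I (x + y)"
    "r \<odot>\<^bsub>quot_ring I\<^esub> coset I x = coset I (r * x)"
proof -
  have "coset I x \<oplus>\<^bsub>quot_ring I\<^esub> coset I y = (\<Union>a\<in>coset I x. \<Union>b\<in>coset I y. {a + b})"
    by (simp add: quot_module_def set_add_def set_mult_def ring_module_def)
  then show "coset I x \<oplus>\<^bsub>quot_ring I\<^esub> coset I y = coset I (x + y)"
    by (simp only: coset_add[OF assms])
  have "r \<odot>\<^bsub>quot_ring I\<^esub> coset I x = (\<Union>a\<in>coset I x. coset I (r * a))"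
    by (simp add: quot_module_def ring_module_coset) (simp add: ring_module_def)
  then show "r \<odot>\<^bsub>quot_ring I\<^esub> coset I x = coset I (r * x)"
    by (simp only: coset_Union[OF assms])
qed

lemma module_quot_ring:
  assumes "is_ideal I"
  shows "module type_ring (quot_ring I)"
  by (rule module_typeI)
    (auto simp: quot_ring_carrier quot_ring_ops[OF assms] quot_ring_zero algebra_simps)

text \<open>
  For \<open>h\<close> the identity this concerns ideals of \<open>S\<close>, for \<open>h\<close> the residue map submodules of \<open>S/I\<close>. The
  submodule is generated by homogeneous elements because a polynomial is the sum of its terms and \<open>h\<close>
  is additive.
\<close>

lemma multigraded_submodule_image:
  fixes M :: "(('n::finite, 'k::field) mpoly, 'm, 'z) module_scheme"
  assumes M: "module type_ring M" and U: "up_closed U"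
    and h: "\<And>x. h x \<in> carrier M" "h 0 = \<zero>\<^bsub>M\<^esub>" "\<And>x y. h (x + y) = h x \<oplus>\<^bsub>M\<^esub> h y"
      "\<And>r x. h (r * x) = r \<odot>\<^bsub>M\<^esub> h x"
  shows "multigraded_submodule M (\<lambda>b. h ` multidegree b) (h ` mono_ideal U)"
proof -
  let ?N = "h ` mono_ideal U" and ?B = "\<Union>b. h ` mono_ideal U \<inter> h ` multidegree b"
  note I = is_idealD[OF is_ideal_mono_ideal[OF U]]
  have sub: "submodule ?N type_ring M"
    unfolding submodule_iff[OF M]
  proof (intro conjI ballI allI)
    show "?N \<subseteq> carrier M" using h(1) by blast
    show "\<zero>\<^bsub>M\<^esub> \<in> ?N" using I(1) h(2) by (metis imageI)
    fix x assume "x \<in> ?N"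
    then obtain x' where x: "x' \<in> mono_ideal U" "x = h x'" by blast
    show "r \<odot>\<^bsub>M\<^esub> x \<in> ?N" for r using x I(3) h(4) by (metis imageI)
    fix y assume "y \<in> ?N"
    then obtain y' where y: "y' \<in> mono_ideal U" "y = h y'" by blast
    show "x \<oplus>\<^bsub>M\<^esub> y \<in> ?N" using x y I(2) h(3) by (metis imageI)
  qed
  have "h p \<in> N" if "submodule N type_ring M" "?B \<subseteq> N" "p \<in> mono_ideal U" for N p
    using that(3)
  proof (induction rule: mono_ideal_induct)
    case zero
    then show ?case using that(1) h(2) unfolding submodule_iff[OF M] by simp
  next
    case (add p q)
    then show ?case using that(1) h(3) unfolding submodule_iff[OF M] by simp
  next
    case (monomial m c)
    have "Poly_Mapping.single m c \<in> multidegree (\<lambda>i. int (Poly_Mapping.lookup m i))"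
      by (simp add: multidegree_def)
    moreover have "Poly_Mapping.single m c \<in> mono_ideal U" using monomial by simp
    ultimately show ?case using that(2) by blast
  qed
  then have "?N = submodule_gen M ?B"
    unfolding submodule_gen_def using sub by blast
  then show ?thesis using sub by (simp add: multigraded_submodule_def)
qed

text \<open>
  For \<open>I \<subseteq> J\<close>, the residue class of \<open>x\<close> in \<open>(R/I)/(J/I)\<close> is the set \<open>coset I ` coset J x\<close> of classes
  modulo \<open>I\<close>. This lemma and the next identify \<open>(R/I)/(J/I)\<close> with \<open>R/J\<close>.
\<close>

lemma coset_image_mem:
  assumes "is_ideal I" "is_ideal J" "I \<subseteq> J"
  shows "coset I z \<in> coset I ` coset J x \<longleftrightarrow> z - x \<in> J"
proof
  assume "coset I z \<in> coset I ` coset J x"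
  then obtain y where y: "z - y \<in> I" "y - x \<in> J"
    by (auto simp: coset_eq_iff[OF assms(1)] coset_mem)
  then show "z - x \<in> J" using is_idealD(2)[OF assms(2), of "z - y" "y - x"] assms(3) by auto
qed (simp add: coset_mem)

lemma coset_image_eq_iff:
  assumes "is_ideal I" "is_ideal J" "I \<subseteq> J"
  shows "coset I ` coset J x = coset I ` coset J y \<longleftrightarrow> x - y \<in> J"
proof
  assume "coset I ` coset J x = coset I ` coset J y"
  then have "coset I x \<in> coset I ` coset J y"
    using coset_image_mem[OF assms, of x x] is_idealD(1)[OF assms(2)] by simp
  then show "x - y \<in> J" by (simp add: coset_image_mem[OF assms])
next
  assume "x - y \<in> J"
  then have "coset J x = coset J y" by (simp add: coset_eq_iff[OF assms(2)])
  then show "coset I ` coset J x = coset I ` coset J y" by simp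
qed

text \<open>
  If \<open>J' = J + (v)\<close> and \<open>P = J : v\<close>, then \<open>(J'/I)/(J/I) \<cong> R/P\<close>, with the class of \<open>q v\<close>
  corresponding to the class of \<open>q\<close>. The isomorphism is
  taken in the direction that sends a class \<open>C\<close> to its preimage \<open>{r. r v \<in> C}\<close>, which is a coset of \<open>P\<close>
  and needs no choice of representatives. The assumptions on \<open>D\<close> say that \<open>v\<close> is homogeneous of degree
  \<open>a\<close> and that homogeneous elements of \<open>J'\<close> are, modulo \<open>J\<close>, homogeneous multiples of \<open>v\<close>.
\<close>

lemma multigraded_iso_cyclic_factor:
  fixes v :: "'r::comm_ring_1" and D :: "('n \<Rightarrow> int) \<Rightarrow> 'r set"
  assumes I: "is_ideal I" and J: "is_ideal J" and J': "is_ideal J'" and sub: "I \<subseteq> J" "J \<subseteq> J'"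
    and v: "v \<in> J'" and gen: "\<And>x. x \<in> J' \<Longrightarrow> \<exists>r. x - r * v \<in> J"
    and P: "is_ideal P" "\<And>r. r \<in> P \<longleftrightarrow> r * v \<in> J"
    and D1: "\<And>b y. y \<in> D b \<Longrightarrow> y \<in> J' \<Longrightarrow> \<exists>r\<in>D (\<lambda>i. b i - a i). y - r * v \<in> J"
    and D2: "\<And>b r. r \<in> D (\<lambda>i. b i - a i) \<Longrightarrow> r * v \<in> D b"
  shows "multigraded_iso
    (quot_module ((quot_ring I)\<lparr>carrier := coset I ` J'\<rparr>) (coset I ` J))
    (quot_grading (quot_ring I) (coset I ` J) (\<lambda>b. coset I ` J' \<inter> quot_grading ring_module I D b))
    (quot_ring P) (shift_grading a (quot_grading ring_module P D))"
proof -
  let ?M = "quot_ring I" and ?N = "coset I ` J"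
  let ?Q = "quot_module (?M\<lparr>carrier := coset I ` J'\<rparr>) ?N"
  (* The class of q v, the image of q under the inverse map. *)
  define E where "E q = coset I ` coset J (q * v)" for q
  have cos: "?N +>\<^bsub>?M\<^esub> coset I x = coset I ` coset J x" for x
    by (auto simp: a_r_coset_eq quot_ring_ops[OF I] coset_def[of J] image_image)
  have upd: "a_r_coset (?M\<lparr>carrier := Z\<rparr>) N x = N +>\<^bsub>?M\<^esub> x" for N Z x
    by (simp add: a_r_coset_eq)
  have Eex: "\<exists>q. coset I ` coset J x = E q" if "x \<in> J'" for x
    using gen[OF that] by (auto simp: E_def coset_image_eq_iff[OF I J sub(1)])
  have vJ: "q * v \<in> J'" for q using is_idealD(3)[OF J' v] .
  have E_eq: "E q = E q' \<longleftrightarrow> q - q' \<in> P" for q q'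
    unfolding E_def coset_image_eq_iff[OF I J sub(1)] P(2) by (simp add: left_diff_distrib)
  have carr: "carrier ?Q = range E"
  proof -
    have "carrier ?Q = {coset I ` coset J x | x. x \<in> J'}"
      unfolding quot_module_carrier by (auto simp: upd cos image_image)
    also have "\<dots> = range E"
    proof
      show "{coset I ` coset J x | x. x \<in> J'} \<subseteq> range E" using Eex by blast
      show "range E \<subseteq> {coset I ` coset J x | x. x \<in> J'}" unfolding E_def using vJ by blast
    qed
    finally show ?thesis .
  qed
  have E_add: "E q \<oplus>\<^bsub>?Q\<^esub> E q' = E (q + q')" for q q'
  proof -
    have "E q \<oplus>\<^bsub>?Q\<^esub> E q' = (\<Union>x\<in>E q. \<Union>y\<in>E q'. {x \<oplus>\<^bsub>?M\<^esub> y})"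
      by (simp add: quot_module_def[of "?M\<lparr>carrier := coset I ` J'\<rparr>"] set_add_def set_mult_def)
    also have "\<dots> = coset I ` (\<Union>x\<in>coset J (q * v). \<Union>y\<in>coset J (q' * v). {x + y})"
      by (auto simp: E_def quot_ring_ops[OF I])
    also have "\<dots> = E (q + q')" by (simp add: coset_add[OF J] E_def distrib_right)
    finally show ?thesis .
  qed
  have E_smult: "r \<odot>\<^bsub>?Q\<^esub> E q = E (r * q)" for r q
  proof -
    have "r \<odot>\<^bsub>?Q\<^esub> E q = (\<Union>x\<in>E q. ?N +>\<^bsub>?M\<^esub> (r \<odot>\<^bsub>?M\<^esub> x))"
      by (simp add: quot_module_def[of "?M\<lparr>carrier := coset I ` J'\<rparr>"] upd)
    also have "\<dots> = (\<Union>x\<in>coset J (q * v). coset I ` coset J (r * x))"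
      by (simp add: E_def quot_ring_ops[OF I] cos)
    also have "\<dots> = coset I ` (\<Union>x\<in>coset J (q * v). coset J (r * x))" by blast
    also have "\<dots> = E (r * q)" by (simp add: coset_Union[OF J] E_def mult.assoc)
    finally show ?thesis .
  qed
  define \<phi> where "\<phi> C = {r. coset I (r * v) \<in> C}" for C
  have \<phi>_E: "\<phi> (E q) = coset P q" for q
    by (auto simp: \<phi>_def E_def coset_image_mem[OF I J sub(1)] coset_mem P(2) left_diff_distrib)
  have "bij_betw \<phi> (carrier ?Q) (carrier (quot_ring P))"
    unfolding carr quot_ring_carrier bij_betw_def
  proof
    show "inj_on \<phi> (range E)" by (auto simp: inj_on_def \<phi>_E E_eq coset_eq_iff[OF P(1)])
    show "\<phi> ` range E = range (coset P)" by (simp add: image_image \<phi>_E)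
  qed
  moreover have "\<phi> (x \<oplus>\<^bsub>?Q\<^esub> y) = \<phi> x \<oplus>\<^bsub>quot_ring P\<^esub> \<phi> y"
    if "x \<in> carrier ?Q" "y \<in> carrier ?Q" for x y
    using that by (auto simp: carr E_add \<phi>_E quot_ring_ops[OF P(1)])
  moreover have "\<phi> (r \<odot>\<^bsub>?Q\<^esub> x) = r \<odot>\<^bsub>quot_ring P\<^esub> \<phi> x" if "x \<in> carrier ?Q" for r x
    using that by (auto simp: carr E_smult \<phi>_E quot_ring_ops[OF P(1)])
  moreover have "\<phi> ` quot_grading ?M ?N (\<lambda>b. coset I ` J' \<inter> quot_grading ring_module I D b) b
      = shift_grading a (quot_grading ring_module P D) b" for b
  proof -
    have eq: "quot_grading ?M ?N (\<lambda>b. coset I ` J' \<inter> quot_grading ring_module I D b) b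
        = E ` D (\<lambda>i. b i - a i)"
    proof (intro equalityI subsetI)
      fix Z assume "Z \<in> quot_grading ?M ?N (\<lambda>b. coset I ` J' \<inter> quot_grading ring_module I D b) b"
      then obtain x y where xy: "x \<in> J'" "y \<in> D b" "coset I y = coset I x" "Z = ?N +>\<^bsub>?M\<^esub> coset I y"
        by (auto simp: quot_grading_def ring_module_coset)
      have "y - x \<in> J'" using xy(3) sub by (auto simp: coset_eq_iff[OF I])
      then have "y \<in> J'" using is_idealD(2)[OF J', of "y - x" x] xy(1) by simp
      then obtain r where r: "r \<in> D (\<lambda>i. b i - a i)" "y - r * v \<in> J" using D1[OF xy(2)] by blast
      have "Z = E r" using r(2) by (simp add: xy(4) cos E_def coset_image_eq_iff[OF I J sub(1)])
      then show "Z \<in> E ` D (\<lambda>i. b i - a i)" using r(1) by blast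
    next
      fix Z assume "Z \<in> E ` D (\<lambda>i. b i - a i)"
      then obtain r where r: "r \<in> D (\<lambda>i. b i - a i)" "Z = E r" by blast
      then have "Z = ?N +>\<^bsub>?M\<^esub> coset I (r * v)" by (simp add: cos E_def)
      moreover have "coset I (r * v) \<in> coset I ` J' \<inter> coset I ` D b" using D2[OF r(1)] vJ by blast
      ultimately show "Z \<in> quot_grading ?M ?N (\<lambda>b. coset I ` J' \<inter> quot_grading ring_module I D b) b"
        by (auto simp: quot_grading_def ring_module_coset)
    qed
    show ?thesis unfolding eq
      by (simp add: image_image \<phi>_E shift_grading_def quot_grading_def ring_module_coset)
  qed
  ultimately show ?thesis unfolding multigraded_iso_def by blast
qed

section \<open>From chains of exponent sets to pretty clean filtrations\<close>

lemma prime_filt_chain: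
  assumes "prime_filt U Fs"
  shows "\<exists>W v. W 0 = U \<and> W (length Fs) = UNIV \<and> (\<forall>i<length Fs.
    W (Suc i) = W i \<union> upward {v i} \<and> shift_upset (W i) (v i) = var_upset (Fs ! i))"
  using assms
proof (induction rule: prime_filt.induct)
  case whole
  show ?case by (intro exI[of _ "\<lambda>_. UNIV"]) simp
next
  case (step U v F Fs)
  then obtain W w where W: "W 0 = U \<union> upward {v}" "W (length Fs) = UNIV" "\<forall>i<length Fs.
    W (Suc i) = W i \<union> upward {w i} \<and> shift_upset (W i) (w i) = var_upset (Fs ! i)" by blast
  show ?case
    by (intro exI[of _ "case_nat U W"] exI[of _ "case_nat v w"])
      (use W step.hyps(1) in \<open>auto simp: nth_Cons split: nat.split\<close>)
qed

lemma multidegree_cases: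
  assumes "y \<in> multidegree b"
  shows "\<exists>m c. y = Poly_Mapping.single m c \<and> (c \<noteq> 0 \<longrightarrow> (\<forall>i. int (Poly_Mapping.lookup m i) = b i))"
proof (cases "y = 0")
  case True
  then show ?thesis by (intro exI[of _ 0]) simp
next
  case False
  then obtain m where m: "m \<in> Poly_Mapping.keys y"
    by (metis in_keys_iff lookup_zero poly_mapping_eqI)
  have "l = m" if "l \<in> Poly_Mapping.keys y" for l
  proof (rule poly_mapping_eqI)
    fix i have "int (Poly_Mapping.lookup l i) = int (Poly_Mapping.lookup m i)"
      using assms that m by (simp add: multidegree_def)
    then show "Poly_Mapping.lookup l i = Poly_Mapping.lookup m i" by simp
  qed
  then have "Poly_Mapping.keys y = {m}" using m by blast
  then have "y = Poly_Mapping.single m (Poly_Mapping.lookup y m)"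
    using sum_single[of y] by simp
  moreover have "\<forall>i. int (Poly_Mapping.lookup m i) = b i" using assms m by (simp add: multidegree_def)
  ultimately show ?thesis by blast
qed

lemma quot_grading_ring_module: "quot_grading ring_module I D = (\<lambda>b. coset I ` D b)"
  by (simp add: quot_grading_def ring_module_coset)

text \<open>
  Modulo the smaller ideal, a term of the larger one either vanishes or is a multiple of \<open>x\<^sup>e\<close>. A
  homogeneous polynomial is a single term, so the quotient of homogeneous elements by \<open>x\<^sup>e\<close> is again
  homogeneous.
\<close>

lemma multigraded_iso_monomial_factor:
  fixes I :: "('n::finite, 'k::field) mpoly set"
  assumes I: "is_ideal I" and W: "up_closed W" and sub: "I \<subseteq> mono_ideal W"
    and F: "shift_upset W (Poly_Mapping.lookup e) = var_upset F"
  shows "multigraded_iso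
    (quot_module ((quot_ring I)\<lparr>carrier := coset I ` mono_ideal (W \<union> upward {Poly_Mapping.lookup e})\<rparr>)
      (coset I ` mono_ideal W))
    (quot_grading (quot_ring I) (coset I ` mono_ideal W)
      (\<lambda>b. coset I ` mono_ideal (W \<union> upward {Poly_Mapping.lookup e}) \<inter> quot_grading ring_module I multidegree b))
    (quot_ring (mono_ideal (var_upset F)))
    (shift_grading (\<lambda>i. int (Poly_Mapping.lookup e i))
      (quot_grading ring_module (mono_ideal (var_upset F)) multidegree))"
proof (rule multigraded_iso_cyclic_factor[where v = "Poly_Mapping.single e 1"])
  let ?e = "Poly_Mapping.lookup e" and ?v = "Poly_Mapping.single e 1 :: ('n, 'k) mpoly"
  have up: "up_closed (W \<union> upward {?e})" by (rule up_closed_Un[OF W up_closed_upward])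
  note J = is_idealD[OF is_ideal_mono_ideal[OF W]]
  have split: "m - e + e = m" if "?e \<le> Poly_Mapping.lookup m" for m
    using that by (intro poly_mapping_eqI) (simp add: lookup_add lookup_minus le_fun_def)
  show "is_ideal I" by (rule I)
  show "is_ideal (mono_ideal W)" by (rule is_ideal_mono_ideal[OF W])
  show "is_ideal (mono_ideal (W \<union> upward {?e}))" by (rule is_ideal_mono_ideal[OF up])
  show "I \<subseteq> mono_ideal W" by (rule sub)
  show "mono_ideal W \<subseteq> mono_ideal (W \<union> upward {?e})" by (auto simp: mono_ideal_def)
  show "?v \<in> mono_ideal (W \<union> upward {?e})" by (simp add: upward_def)
  show "is_ideal (mono_ideal (var_upset F))" by (rule is_ideal_mono_ideal[OF up_closed_var_upset])
  show "r \<in> mono_ideal (var_upset F) \<longleftrightarrow> r * ?v \<in> mono_ideal W" for r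
    using mult_monomial_in_mono_ideal[OF W, of r e] by (simp add: F)
  have reduce: "Poly_Mapping.single m c - 0 * ?v \<in> mono_ideal W \<or>
      ?e \<le> Poly_Mapping.lookup m \<and> Poly_Mapping.single m c - Poly_Mapping.single (m - e) c * ?v \<in> mono_ideal W"
    if "Poly_Mapping.lookup m \<in> W \<union> upward {?e}" for m c
    using that J(1) by (auto simp: mult_single split upward_def)
  show "\<exists>r. x - r * ?v \<in> mono_ideal W" if "x \<in> mono_ideal (W \<union> upward {?e})" for x
    using that
  proof (induction rule: mono_ideal_induct)
    case zero
    show ?case using J(1) by (intro exI[of _ 0]) simp
  next
    case (add p q)
    then obtain r s where "p - r * ?v \<in> mono_ideal W" "q - s * ?v \<in> mono_ideal W" by blast
    from J(2)[OF this] show ?case by (intro exI[of _ "r + s"]) (simp add: algebra_simps)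
  next
    case (monomial m c)
    then show ?case using reduce by blast
  qed
  show "\<exists>r\<in>multidegree (\<lambda>i. b i - int (?e i)). y - r * ?v \<in> mono_ideal W"
    if y: "y \<in> multidegree b" "y \<in> mono_ideal (W \<union> upward {?e})" for b y
  proof -
    obtain m c where m: "y = Poly_Mapping.single m c"
      "c \<noteq> 0 \<Longrightarrow> \<forall>i. int (Poly_Mapping.lookup m i) = b i" using multidegree_cases[OF y(1)] by blast
    have zero: "0 \<in> multidegree (\<lambda>i. b i - int (?e i))" by (simp add: multidegree_def)
    show ?thesis
    proof (cases "c = 0 \<or> y \<in> mono_ideal W")
      case True
      then show ?thesis using zero J(1) m(1) by (intro bexI[of _ 0]) auto
    next
      case False
      then have "Poly_Mapping.lookup m \<in> W \<union> upward {?e}" using y(2) m(1) by simp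
      then have e: "?e \<le> Poly_Mapping.lookup m" using False m(1) by (auto simp: upward_def)
      have "int (Poly_Mapping.lookup (m - e) i) = b i - int (?e i)" for i
        using m(2) False e by (simp add: lookup_minus le_fun_def of_nat_diff)
      then have "Poly_Mapping.single (m - e) c \<in> multidegree (\<lambda>i. b i - int (?e i))"
        by (simp add: multidegree_def)
      moreover have "y - Poly_Mapping.single (m - e) c * ?v \<in> mono_ideal W"
        using J(1) by (simp add: m(1) mult_single split[OF e])
      ultimately show ?thesis by blast
    qed
  qed
  show "r * ?v \<in> multidegree b" if r: "r \<in> multidegree (\<lambda>i. b i - int (?e i))" for b r
  proof -
    obtain m c where m: "r = Poly_Mapping.single m c"
      "c \<noteq> 0 \<Longrightarrow> \<forall>i. int (Poly_Mapping.lookup m i) = b i - int (?e i)" using multidegree_cases[OF r] by blast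
    then show ?thesis by (auto simp: mult_single multidegree_def lookup_add)
  qed
qed

text \<open>
  The number of variables in \<open>F\<close> is the height of the prime that they generate. If \<open>i < j\<close> and
  \<open>F\<^sub>i \<subseteq> F\<^sub>j\<close>, then \<open>card F\<^sub>j \<le> card F\<^sub>i\<close> leaves only \<open>F\<^sub>i = F\<^sub>j\<close>.
\<close>

theorem pretty_clean_prime_filt:
  fixes U :: "('n::finite \<Rightarrow> nat) set"
  assumes U: "up_closed U" and Fs: "prime_filt U Fs"
    and sorted: "sorted_wrt (\<lambda>F G. card G \<le> card F) Fs"
  defines "I \<equiv> mono_ideal U :: ('n, 'k::field) mpoly set"
  shows "pretty_clean (quot_ring I) (quot_grading ring_module I multidegree)"
proof -
  obtain W v where W: "W 0 = U" "W (length Fs) = UNIV" and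
    step: "\<And>i. i < length Fs \<Longrightarrow> W (Suc i) = W i \<union> upward {v i}"
      "\<And>i. i < length Fs \<Longrightarrow> shift_upset (W i) (v i) = var_upset (Fs ! i)"
    using prime_filt_chain[OF Fs] by blast
  define e where "e i = Abs_poly_mapping (v i)" for i
  have e: "Poly_Mapping.lookup (e i) = v i" for i by (simp add: e_def)
  define P where "P i = (mono_ideal (var_upset (Fs ! (i - 1))) :: ('n, 'k) mpoly set)" for i
  have WU: "up_closed (W i) \<and> U \<subseteq> W i" if "i \<le> length Fs" for i
    using that
  proof (induction i)
    case (Suc i)
    then show ?case using step(1)[of i] up_closed_Un[OF _ up_closed_upward] by auto
  qed (simp add: W U)
  have I: "is_ideal I" unfolding I_def by (rule is_ideal_mono_ideal[OF U])
  have sub: "I \<subseteq> mono_ideal (W i)" if "i \<le> length Fs" for i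
    using WU[OF that] by (auto simp: I_def mono_ideal_def)
  have "prime_filtration (quot_ring I) (quot_grading ring_module I multidegree) (length Fs)
    (\<lambda>i. coset I ` mono_ideal (W i)) P (\<lambda>i j. int (v (i - 1) j))"
    unfolding prime_filtration_def
  proof (intro conjI allI ballI impI)
    have "coset I ` I = (\<lambda>_. coset I 0) ` I" by (rule image_cong) (simp_all add: coset_eq_iff[OF I])
    also have "\<dots> = {coset I 0}" by (rule image_constant[OF is_idealD(1)[OF I]])
    finally show "coset I ` mono_ideal (W 0) = {\<zero>\<^bsub>quot_ring I\<^esub>}"
      by (simp only: W(1) I_def[symmetric] quot_ring_zero)
    have "mono_ideal UNIV = (UNIV :: ('n, 'k) mpoly set)" by (auto simp: mono_ideal_def)
    then show "coset I ` mono_ideal (W (length Fs)) = carrier (quot_ring I)"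
      by (simp add: W(2) quot_ring_carrier)
  next
    fix i assume "i \<le> length Fs"
    then have "up_closed (W i)" using WU by blast
    then show "multigraded_submodule (quot_ring I) (quot_grading ring_module I multidegree)
        (coset I ` mono_ideal (W i))"
      unfolding quot_grading_ring_module
      by (intro multigraded_submodule_image module_quot_ring[OF I])
        (auto simp: quot_ring_carrier quot_ring_zero quot_ring_ops[OF I])
  next
    fix i assume "i \<in> {1..length Fs}"
    then obtain j where j: "i = Suc j" "j < length Fs" by (cases i) auto
    have Wj: "up_closed (W j)" using WU[of j] j by simp
    show "coset I ` mono_ideal (W (i - 1)) \<subset> coset I ` mono_ideal (W i)"
    proof
      show "coset I ` mono_ideal (W (i - 1)) \<subseteq> coset I ` mono_ideal (W i)"
        using step(1)[OF j(2)] by (auto simp: j(1) mono_ideal_def)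
      let ?x = "Poly_Mapping.single (e j) 1 :: ('n, 'k) mpoly"
      have "0 \<notin> shift_upset (W j) (v j)" by (simp add: step(2)[OF j(2)] var_upset_def)
      then have "v j \<notin> W j" by (simp add: shift_upset_def)
      then have "?x \<notin> mono_ideal (W j)" by (simp add: e)
      then have "coset I ?x \<notin> coset I ` mono_ideal (W j)"
        using coset_image_mem[OF I is_ideal_mono_ideal[OF Wj] sub[OF less_imp_le[OF j(2)]], of ?x 0]
        by (auto simp: coset_def[of _ 0])
      moreover have "?x \<in> mono_ideal (W (Suc j))" by (simp add: e step(1)[OF j(2)] upward_def)
      ultimately show "coset I ` mono_ideal (W (i - 1)) \<noteq> coset I ` mono_ideal (W i)"
        using j(1) by auto
    qed
    show "primeideal (P i) ring_of_type_algebra" unfolding P_def by (rule primeideal_var_upset)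
    have "module type_ring (ring_module :: (('n, 'k) mpoly, ('n, 'k) mpoly) module)"
      by (rule module_typeI) (auto simp: ring_module_def algebra_simps)
    from multigraded_submodule_image[OF this up_closed_var_upset, of "\<lambda>x. x"]
    show "multigraded_submodule ring_module multidegree (P i)"
      unfolding P_def by (simp add: ring_module_def)
    show "multigraded_iso
        (quot_module (quot_ring I\<lparr>carrier := coset I ` mono_ideal (W i)\<rparr>) (coset I ` mono_ideal (W (i - 1))))
        (quot_grading (quot_ring I) (coset I ` mono_ideal (W (i - 1)))
          (\<lambda>b. coset I ` mono_ideal (W i) \<inter> quot_grading ring_module I multidegree b))
        (quot_ring (P i))
        (shift_grading (\<lambda>k. int (v (i - 1) k)) (quot_grading ring_module (P i) multidegree))"
      using multigraded_iso_monomial_factor[OF I Wj sub[OF less_imp_le[OF j(2)]], of "e j" "Fs ! j"] j step[OF j(2)]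
      by (simp add: e P_def)
  qed
  moreover have "P i = P j" if "i \<in> {1..length Fs}" "j \<in> {1..length Fs}" "i < j \<and> P i \<subseteq> P j" for i j
  proof -
    have "Fs ! (i - 1) \<subseteq> Fs ! (j - 1)"
      using that(3) mono_ideal_var_upset_subset unfolding P_def by blast
    moreover have "card (Fs ! (j - 1)) \<le> card (Fs ! (i - 1))"
      using that by (intro sorted_wrt_nth_less[OF sorted]) auto
    ultimately have "Fs ! (i - 1) = Fs ! (j - 1)" by (intro card_seteq) auto
    then show ?thesis by (simp add: P_def)
  qed
  ultimately show ?thesis unfolding pretty_clean_def by blast
qed

section \<open>Divisibility for the generators\<close>

lemma gcd_chainI:
  assumes "\<And>a p q. a \<in> A \<Longrightarrow> p < q \<Longrightarrow> q < length ws \<Longrightarrow> inf a (ws ! p) \<le> ws ! q"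
    and "\<And>i j k. i < j \<Longrightarrow> j < k \<Longrightarrow> k < length ws \<Longrightarrow> inf (ws ! i) (ws ! j) \<le> ws ! k"
  shows "gcd_chain A ws"
  using assms
proof (induction ws arbitrary: A)
  case (Cons w ws)
  have "inf a w \<le> w'" if "a \<in> A" "w' \<in> set ws" for a w'
  proof -
    from that(2) obtain q where "q < length ws" "w' = ws ! q" by (auto simp: in_set_conv_nth)
    then show ?thesis using Cons.prems(1)[OF that(1), of 0 "Suc q"] by (simp add: le_fun_def)
  qed
  moreover have "gcd_chain (insert w A) ws"
  proof (rule Cons.IH)
    fix a p q assume "a \<in> insert w A" "p < q" "q < length ws"
    then show "inf a (ws ! p) \<le> ws ! q"
      using Cons.prems(1)[of a "Suc p" "Suc q"] Cons.prems(2)[of 0 "Suc p" "Suc q"] by (auto simp: le_fun_def)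
  next
    fix i j k assume "i < j" "j < k" "k < length ws"
    then show "inf (ws ! i) (ws ! j) \<le> ws ! k" using Cons.prems(2)[of "Suc i" "Suc j" "Suc k"] by (simp add: le_fun_def)
  qed
  ultimately show ?case by simp
qed simp

text \<open>
  Let \<open>w = u\<^sub>i / gcd(u\<^sub>i, u\<^sub>j)\<close>. Since \<open>u\<^sub>i\<close> divides \<open>w u\<^sub>j\<close>, some \<open>u\<^sub>l\<close> with \<open>l < j\<close> divides \<open>w u\<^sub>k\<close>. If
  \<open>l = i\<close>, this says that \<open>gcd(u\<^sub>i, u\<^sub>j)\<close> divides \<open>u\<^sub>k\<close>. The case \<open>l \<noteq> i\<close> contradicts minimality: by induction
  \<open>gcd(u\<^sub>i, u\<^sub>l)\<close> divides \<open>u\<^sub>j\<close> and \<open>u\<^sub>k\<close>, and comparing exponents in each variable then shows that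
  \<open>u\<^sub>l\<close> divides \<open>u\<^sub>k\<close>.
\<close>

lemma gcd_divides_later:
  fixes es :: "('n \<Rightarrow> nat) list"
  assumes stable: "\<And>i j k w. i < j \<Longrightarrow> j < k \<Longrightarrow> k < length es \<Longrightarrow> es ! i \<le> w + es ! j \<Longrightarrow>
      \<exists>l<j. es ! l \<le> w + es ! k"
    and minimal: "\<And>l k. l < k \<Longrightarrow> k < length es \<Longrightarrow> \<not> es ! l \<le> es ! k"
  shows "i < j \<Longrightarrow> j < k \<Longrightarrow> k < length es \<Longrightarrow> inf (es ! i) (es ! j) \<le> es ! k"
proof (induction j arbitrary: i k rule: less_induct)
  case (less j)
  define w where "w = es ! i - es ! j"
  have "es ! i \<le> w + es ! j" by (auto simp: w_def le_fun_def)
  then obtain l where l: "l < j" "es ! l \<le> w + es ! k"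
    using stable less.prems by blast
  have "l = i"
  proof (rule ccontr)
    assume "l \<noteq> i"
    have gcd: "inf (es ! i) (es ! l) \<le> es ! q" if "j \<le> q" "q < length es" for q
    proof (cases "l < i")
      case True
      then show ?thesis using less.IH[of i l q] less.prems that by (simp add: le_fun_def inf_commute)
    next
      case False
      then show ?thesis using less.IH[of l i q] less.prems \<open>l \<noteq> i\<close> l(1) that
        by (simp add: le_fun_def inf_commute)
    qed
    have "es ! l \<le> es ! k"
    proof (rule le_funI)
      fix x
      have "min ((es ! i) x) ((es ! l) x) \<le> (es ! k) x" "min ((es ! i) x) ((es ! l) x) \<le> (es ! j) x"
        using gcd[of k] gcd[of j] less.prems by (simp_all add: le_fun_def inf_nat_def)
      moreover have "(es ! l) x \<le> ((es ! i) x - (es ! j) x) + (es ! k) x"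
        using l(2) by (simp add: le_fun_def w_def)
      ultimately show "(es ! l) x \<le> (es ! k) x" by linarith
    qed
    then show False using minimal[of l k] l(1) less.prems by simp
  qed
  show ?case
  proof (rule le_funI)
    fix x
    have "(es ! i) x \<le> ((es ! i) x - (es ! j) x) + (es ! k) x"
      using l(2) \<open>l = i\<close> by (simp add: le_fun_def w_def)
    then show "inf (es ! i) (es ! j) x \<le> (es ! k) x" by (simp add: inf_nat_def)
  qed
qed

theorem proposition4p4:
  fixes I :: "('n::finite, 'k::field) mpoly set"
    and us :: "('n, 'k) mpoly list"
  assumes "monomial_ideal I"
    and "distinct us"
    and "minimal_monomial_generators I (set us)"
    and "d_sequence us \<or> proper_sequence us \<or>
         strong_s_sequence revlex_less (ring_module\<lparr>carrier := I\<rparr>) us"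
  shows "pretty_clean (quot_module ring_module I) (quot_grading ring_module I multidegree)"
proof -
  have gens: "set us \<subseteq> monomials" "ideal_gen (set us) = I" "\<And>H. H \<subset> set us \<Longrightarrow> ideal_gen H \<noteq> I"
    using assms(3) by (auto simp: minimal_monomial_generators_def)
  have I: "is_ideal I" using ideal_gen_ideal[of "set us"] gens(2) by simp
  have stable: "colon_stable us"
    using assms(4) d_sequence_colon_stable proper_sequence_colon_stable
      strong_s_sequence_colon_stable[OF I] by blast
  have "\<exists>E. us = map (\<lambda>m. Poly_Mapping.single m 1) E"
    using gens(1) unfolding ex_map_conv monomials_def by blast
  then obtain E where E: "us = map (\<lambda>m. Poly_Mapping.single m 1) E" by blast
  define es where "es = map Poly_Mapping.lookup E"
  have len: "length es = length us" "length E = length us" by (simp_all add: es_def E)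
  have pre: "prefix_ideal us j = mono_ideal (upward (set (take j es)))" for j
    using ideal_gen_monomials[of "set (take j E)"] by (simp add: E es_def take_map)
  have I_eq: "I = mono_ideal (upward (set es))"
    using pre[of "length us"] gens(2) len by simp
  have pre_mem: "w \<in> upward (set (take j es)) \<longleftrightarrow> (\<exists>l<j. es ! l \<le> w)" if "j \<le> length es" for w j
    using nth_image[OF that] by (auto simp: upward_def atLeast0LessThan simp flip: nth_image[OF that])
  have mult: "Poly_Mapping.single (Abs_poly_mapping w) 1 * us ! j =
      Poly_Mapping.single (Abs_poly_mapping w + E ! j) 1"
    "Poly_Mapping.lookup (Abs_poly_mapping w + E ! j) = w + es ! j" if "j < length us" for w j
  proof -
    have jE: "j < length E" using that len(2) by simp
    have j: "us ! j = Poly_Mapping.single (E ! j) 1" "es ! j = Poly_Mapping.lookup (E ! j)"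
      using jE by (simp_all add: E es_def)
    show "Poly_Mapping.single (Abs_poly_mapping w) 1 * us ! j =
        Poly_Mapping.single (Abs_poly_mapping w + E ! j) 1"
      by (simp only: j(1) mult_single mult_1)
    show "Poly_Mapping.lookup (Abs_poly_mapping w + E ! j) = w + es ! j"
      by (rule ext) (simp add: j(2) lookup_add)
  qed
  have chain: "inf (es ! i) (es ! j) \<le> es ! k" if "i < j" "j < k" "k < length es" for i j k
  proof (rule gcd_divides_later[OF _ _ that])
    fix i j k w assume ijk: "i < j" "j < k" "k < length es" "es ! i \<le> w + es ! j"
    let ?r = "Poly_Mapping.single (Abs_poly_mapping w) 1 :: ('n, 'k) mpoly"
    have "?r * us ! j \<in> prefix_ideal us j"
      using ijk len by (auto simp: mult pre pre_mem)
    then have "?r * us ! k \<in> prefix_ideal us j"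
      using stable ijk len by (simp add: colon_stable_def)
    then show "\<exists>l<j. es ! l \<le> w + es ! k"
      using ijk len by (auto simp: mult pre pre_mem)
  next
    fix l k assume lk: "l < k" "k < length es"
    show "\<not> es ! l \<le> es ! k"
    proof
      assume le: "es ! l \<le> es ! k"
      have kE: "k < length E" using lk(2) len by simp
      let ?H = "set us - {us ! k}"
      have "us ! l \<in> ?H" using lk len assms(2) by (simp add: nth_eq_iff_index_eq)
      have "E ! k - E ! l + E ! l = E ! k"
        using le lk(1) kE by (intro poly_mapping_eqI) (simp add: lookup_add lookup_minus le_fun_def es_def)
      then have eq: "us ! k = Poly_Mapping.single (E ! k - E ! l) 1 * us ! l"
        using lk(1) kE by (simp add: E mult_single)
      have "Poly_Mapping.single (E ! k - E ! l) 1 * us ! l \<in> ideal_gen ?H"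
        by (intro is_idealD(3)[OF ideal_gen_ideal] subsetD[OF ideal_gen_subset \<open>us ! l \<in> ?H\<close>])
      then have "us ! k \<in> ideal_gen ?H" by (simp only: eq[symmetric])
      then have "set us \<subseteq> ideal_gen ?H" using ideal_gen_subset[of ?H] by blast
      then have "ideal_gen (set us) \<subseteq> ideal_gen ?H" by (intro ideal_gen_least ideal_gen_ideal)
      moreover have "ideal_gen ?H \<subseteq> ideal_gen (set us)"
        using ideal_gen_subset[of "set us"] by (intro ideal_gen_least ideal_gen_ideal) blast
      moreover have "?H \<subset> set us"
      proof
        have "us ! k \<in> set us" by (rule nth_mem) (use kE len(2) in simp)
        then show "?H \<noteq> set us" by blast
      qed blast
      ultimately show False using gens(2,3) by blast
    qed
  qed
  have "\<exists>Fs. prime_filt (upward (set es)) Fs \<and> sorted_wrt (\<lambda>F G. card G \<le> card F) Fs"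
  proof (cases "0 \<in> set es")
    (* The exponent 0 belongs to the monomial 1, so I = S and the filtration is empty. *)
    case True
    then show ?thesis by (intro exI[of _ "[]"]) (simp add: upward_zero prime_filt.whole)
  next
    case False
    have "regular_exps {}" by (simp add: regular_exps_def)
    moreover have "gcd_chain {} es" by (rule gcd_chainI) (use chain in auto)
    ultimately show ?thesis using prime_filt_gcd_chain[of "{}" es] False by auto
  qed
  then obtain Fs where "prime_filt (upward (set es)) Fs" "sorted_wrt (\<lambda>F G. card G \<le> card F) Fs" by blast
  then show ?thesis unfolding I_eq by (rule pretty_clean_prime_filt[OF up_closed_upward])
qed

end
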